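(* Let $1\le m\le n$ be integers, let $\bar A\in\mathbb{R}^{m\times n}$ satisfy $\|\bar A\|\le 1$, and let $0<\sigma\le 1$. Put $\lambda:=\frac{m-1}{n}$. Then, for every real $z\ge \zeta_\sigma(m,n)$, a random matrix $A\sim N(\bar A,\sigma^2 \mathrm{I})$ satisfies $$ \mathrm{Prob}\Big\{\kappa(A)\ge \frac{e z}{1-\lambda}\Big\}\ \le\ 2c(\lambda)\bigg[\Big(Q(m,n)+\sqrt{2\ln(2z)}+\frac{1}{\sigma\sqrt n}\Big)\frac1z\bigg]^{n-m+1}. $$
   Context: $\|\cdot\|$ denotes the spectral norm of a matrix (operator norm with respect to Euclidean norms). $N(\bar A,\sigma^2\mathrm{I})$ is the isotropic Gaussian distribution on $\mathbb{R}^{m\times n}$: the entries of $A-\bar A$ are independent centered real Gaussians of variance $\sigma^2$. For $A\in\mathbb{R}^{m\times n}$ of full rank with $m\le n$, the Moore-Penrose inverse is $A^\dagger:=A^{\mathrm T}(AA^{\mathrm T})^{-1}$ and the condition number is $\kappa(A):=\|A\|\,\|A^\dagger\|$ (a random Gaussian $A$ has full rank almost surely). $e$ is the base of natural logarithms. Define $Q(m,n):=\frac{1}{\sqrt n}\,\mathbb{E}(\|X\|)$, where $X\in\mathbb{R}^{m\times n}$ is standard Gaussian (i.i.d. $N(0,1)$ entries). Define $c(\lambda):=\sqrt{\frac{1+\lambda}{2(1-\lambda)}}$ for $\lambda\in[0,1)$. With $\lambda=\frac{m-1}{n}$, define $$\zeta_\sigma(m,n):=\Big(Q(m,n)+\frac{1}{\sigma\sqrt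 n}\Big)\,c(\lambda)^{\frac{1}{n-m+1}}.$$ *)

theory Defs
  imports "HOL-Probability.Probability"
begin

definition spectral_norm :: "real ^ 'n ^ 'm \<Rightarrow> real" where
  "spectral_norm A = onorm ((*v) A)"

text \<open>
  The next two definitions are meant for \<open>A\<close> of full row rank, so that \<open>A A\<^sup>T\<close> is invertible.
  On rank-deficient matrices, a null set for the Gaussian laws below, \<open>matrix_inv\<close> takes
  one unspecified constant value.
\<close>

definition moore_penrose :: "real ^ 'n ^ 'm \<Rightarrow> real ^ 'm ^ 'n" where
  "moore_penrose A = transpose A ** matrix_inv (A ** transpose A)"

definition cond_number :: "real ^ 'n ^ 'm \<Rightarrow> real" where
  "cond_number A = spectral_norm A * spectral_norm (moore_penrose A)"

text \<open>
  The law \<open>N(Abar, \<sigma>\<^sup>2 I)\<close>, for \<open>\<sigma> > 0\<close>.  The second argument is the standard deviation, as in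
  \<^const>\<open>normal_density\<close>.
\<close>

definition gaussian_matrix :: "real ^ 'n ^ 'm \<Rightarrow> real \<Rightarrow> (real ^ 'n ^ 'm) measure" where
  "gaussian_matrix Abar \<sigma> =
     distr (\<Pi>\<^sub>M (ij :: 'm \<times> 'n)\<in>UNIV. density lborel (\<lambda>x. ennreal (normal_density 0 \<sigma> x))) borel
       (\<lambda>g. Abar + (\<chi> i j. g (i, j)))"

text \<open>
  In \<open>Q(m,n)\<close> and \<open>\<zeta>\<^sub>\<sigma>(m,n)\<close> the dimensions are the cardinalities of the row index type \<open>'m\<close>
  and the column index type \<open>'n\<close>.
\<close>

definition Q_norm :: "'m::finite itself \<Rightarrow> 'n::finite itself \<Rightarrow> real" where
  "Q_norm _ _ = 1 / sqrt (real CARD('n)) *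
     (\<integral>X. spectral_norm X \<partial>(gaussian_matrix (0 :: real ^ 'n ^ 'm) 1))"

definition c_fun :: "real \<Rightarrow> real" where
  "c_fun l = sqrt ((1 + l) / (2 * (1 - l)))"

definition zeta :: "real \<Rightarrow> 'm::finite itself \<Rightarrow> 'n::finite itself \<Rightarrow> real" where
  "zeta \<sigma> M N =
     (Q_norm M N + 1 / (\<sigma> * sqrt (real CARD('n)))) *
     c_fun ((real CARD('m) - 1) / real CARD('n)) powr (1 / (real CARD('n) - real CARD('m) + 1))"

end

theory Submission
  imports Defs
begin

text \<open>
  If \<open>cond_number A\<close> is large, then \<open>A\<close> has a large norm or a small singular value.

  Large norm: the Prekopa--Leindler inequality for the Gaussian law with weights \<open>t\<close> and
  \<open>1 - t\<close>, applied to \<open>exp (L * g - L\<^sup>2 / (2 * (1 - t)))\<close> and \<open>exp (- t / (1 - t) * L * g)\<close> for a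
  1-Lipschitz \<open>g\<close>, gives as \<open>t\<close> tends to \<open>0\<close> the concentration inequality with the sharp
  exponent \<open>- s\<^sup>2 / 2\<close>.  The inequality tensorizes, so only dimension one has to be treated.

  Small singular value: let \<open>y\<close> be a unit vector with \<open>norm (y v* A) \<le> \<tau>\<close>, and let \<open>u\<close> be a fixed
  vector at an angle of cosine at least \<open>\<rho>\<close> to \<open>y\<close>.  After a rotation taking \<open>u\<close> to a coordinate axis,
  one row of \<open>A\<close> lies within \<open>\<tau> / \<rho>\<close> of the span of the other rows, which is a small-ball event for a
  Gaussian in dimension \<open>k = n - m + 1\<close>.  Averaging over \<open>u\<close> in the unit ball divides the
  probability by the relative volume of a pair of spherical caps; the choice \<open>\<rho>\<^sup>2 = k / n\<close> is optimal.
\<close>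

section \<open>Gaussian concentration\<close>

text \<open>Write k = n - m + 1, d = m - 1 and B = Q + sqrt (2 ln (2 z)) + 1 / (\<sigma> sqrt n).
  The threshold e z / (1 - \<lambda>) is split as \<alpha> T with \<alpha> = \<sigma> sqrt n B:
  either the norm of A reaches \<alpha>, or that of its pseudo-inverse reaches T. Each event has
  probability at most c(\<lambda>) (B / z)^k, hence the factor 2. The sharp exponent matters because
  sqrt (2 ln (2 z)) then makes the first probability (2 z)^(-n); for m = 1 a weaker exponent would
  miss the power k = n for large z. Averaging over u replaces the choice of a large coordinate of y
  and a union bound over the m rows: for k = 1 the latter gives order m^(3/2) \<tau> / \<sigma>,
  while the theorem has room for order m \<tau> / \<sigma>. The number e has two sources: one factor
  exp (- k / 2) comes from Stirling for the k-dimensional ball, the other from the relative size (d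
  / n)^(d/2) of the caps. All small-ball bounds are uniform in the centre, so rotations may move it
  freely.\<close>

lemma nn_integral_layer_cake:
  fixes f :: "'a \<Rightarrow> real"
  assumes "sigma_finite_measure M" and [measurable]: "f \<in> borel_measurable M"
  shows "(\<integral>\<^sup>+x. ennreal (f x) \<partial>M) = (\<integral>\<^sup>+s. indicator {0..} s * emeasure M {x \<in> space M. s < f x} \<partial>lborel)"
proof -
  interpret sigma_finite_measure M by fact
  interpret pair_sigma_finite M lborel ..
  have "(\<integral>\<^sup>+x. ennreal (f x) \<partial>M) = (\<integral>\<^sup>+x. (\<integral>\<^sup>+s. indicator {0..} s * (if s < f x then 1 else 0) \<partial>lborel) \<partial>M)"
  proof (rule nn_integral_cong)
    fix x
    have "(\<integral>\<^sup>+s. indicator {0..} s * (if s < f x then 1 else 0) \<partial>lborel) = (\<integral>\<^sup>+s. indicator {0..<f x} s \<partial>lborel)"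
      by (intro nn_integral_cong) (auto simp: indicator_def)
    also have "\<dots> = emeasure lborel {0..<f x}" by simp
    also have "\<dots> = ennreal (f x)"
      by (cases "0 \<le> f x") (auto simp: ennreal_neg)
    finally show "ennreal (f x) = (\<integral>\<^sup>+s. indicator {0..} s * (if s < f x then 1 else 0) \<partial>lborel)" ..
  qed
  also have "\<dots> = (\<integral>\<^sup>+s. (\<integral>\<^sup>+x. indicator {0..} s * (if s < f x then 1 else 0) \<partial>M) \<partial>lborel)"
    by (intro Fubini'[symmetric]) measurable
  also have "\<dots> = (\<integral>\<^sup>+s. indicator {0..} s * emeasure M {x \<in> space M. s < f x} \<partial>lborel)"
  proof (intro nn_integral_cong)
    fix s :: real
    have "(\<integral>\<^sup>+x. indicator {0..} s * (if s < f x then 1 else 0) \<partial>M)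
        = (\<integral>\<^sup>+x. indicator {0..} s * indicator {x \<in> space M. s < f x} x \<partial>M)"
      by (intro nn_integral_cong) (auto simp: indicator_def)
    then show "(\<integral>\<^sup>+x. indicator {0..} s * (if s < f x then 1 else 0) \<partial>M)
        = indicator {0..} s * emeasure M {x \<in> space M. s < f x}"
      by (simp add: nn_integral_cmult)
  qed
  finally show ?thesis .
qed

lemma emeasure_lborel_le_diam:
  fixes A :: "real set"
  assumes "A \<noteq> {}" "bdd_below A" "bdd_above A"
  shows "emeasure lborel A \<le> ennreal (Sup A - Inf A)"
proof -
  have "A \<subseteq> {Inf A..Sup A}" using assms by (auto intro: cInf_lower cSup_upper)
  then have "emeasure lborel A \<le> emeasure lborel {Inf A..Sup A}" by (intro emeasure_mono) auto
  also have "\<dots> = ennreal (Sup A - Inf A)"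
    using assms by (simp add: cInf_le_cSup)
  finally show ?thesis .
qed

text \<open>This is one-dimensional Brunn--Minkowski when the combined set lies in an interval:
  replacing A and B by their hulls keeps t A + (1 - t) B inside [-r, r], so only suprema and infima
  matter. One element of either set already bounds the other.\<close>

lemma weighted_emeasure_le_interval:
  fixes A B :: "real set" and t r :: real
  assumes t: "0 < t" "t < 1" and ne: "A \<noteq> {}" "B \<noteq> {}"
    and AB: "\<And>a b. a \<in> A \<Longrightarrow> b \<in> B \<Longrightarrow> \<bar>t * a + (1 - t) * b\<bar> \<le> r"
  shows "ennreal t * emeasure lborel A + ennreal (1 - t) * emeasure lborel B \<le> ennreal (2 * r)"
proof -
  obtain a0 b0 where a0: "a0 \<in> A" and b0: "b0 \<in> B" using ne by auto
  have Aup: "a \<le> (r - (1 - t) * b) / t" and Alo: "(- r - (1 - t) * b) / t \<le> a" if "a \<in> A" "b \<in> B" for a b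
    using AB[OF that] t by (auto simp: field_simps abs_le_iff)
  have Bup: "b \<le> (r - t * a) / (1 - t)" and Blo: "(- r - t * a) / (1 - t) \<le> b" if "a \<in> A" "b \<in> B" for a b
    using AB[OF that] t by (auto simp: field_simps abs_le_iff)
  have bA: "bdd_above A" "bdd_below A" unfolding bdd_above_def bdd_below_def
    using Aup[OF _ b0] Alo[OF _ b0] by blast+
  have bB: "bdd_above B" "bdd_below B" unfolding bdd_above_def bdd_below_def
    using Bup[OF a0] Blo[OF a0] by blast+
  have "b \<le> (r - t * Sup A) / (1 - t)" if "b \<in> B" for b
  proof -
    have "Sup A \<le> (r - (1 - t) * b) / t" using Aup[OF _ that] ne by (intro cSup_least)
    then show ?thesis using t by (simp add: field_simps)
  qed
  then have "Sup B \<le> (r - t * Sup A) / (1 - t)" using ne by (intro cSup_least)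
  then have s: "t * Sup A + (1 - t) * Sup B \<le> r" using t by (simp add: field_simps)
  have "(- r - t * Inf A) / (1 - t) \<le> b" if "b \<in> B" for b
  proof -
    have "Inf A \<ge> (- r - (1 - t) * b) / t" using Alo[OF _ that] ne by (intro cInf_greatest)
    then show ?thesis using t by (simp add: field_simps)
  qed
  then have "Inf B \<ge> (- r - t * Inf A) / (1 - t)" using ne by (intro cInf_greatest)
  then have i: "t * Inf A + (1 - t) * Inf B \<ge> - r" using t by (simp add: field_simps)
  have nn: "Sup A - Inf A \<ge> 0" "Sup B - Inf B \<ge> 0" using ne bA bB by (simp_all add: cInf_le_cSup)
  have "ennreal t * emeasure lborel A + ennreal (1 - t) * emeasure lborel B
      \<le> ennreal t * ennreal (Sup A - Inf A) + ennreal (1 - t) * ennreal (Sup B - Inf B)"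
    using ne bA bB by (intro add_mono mult_left_mono emeasure_lborel_le_diam) auto
  also have "\<dots> = ennreal (t * (Sup A - Inf A) + (1 - t) * (Sup B - Inf B))"
    using t nn by (simp add: ennreal_mult' ennreal_plus)
  also have "\<dots> \<le> ennreal (2 * r)" using s i by (intro ennreal_leI) (simp add: algebra_simps)
  finally show ?thesis .
qed

lemma weighted_am_gm:
  fixes a b t :: real
  assumes "0 < t" "t < 1" "0 \<le> a" "0 \<le> b"
  shows "a powr t * b powr (1 - t) \<le> t * a + (1 - t) * b"
proof (cases "a = 0 \<or> b = 0")
  case False
  then have p: "a > 0" "b > 0" using assms by auto
  have "exp (t * ln a + (1 - t) * ln b) \<le> t * exp (ln a) + (1 - t) * exp (ln b)"
    using convex_onD[OF exp_convex, of "1 - t" "ln a" "ln b"] assms by (simp add: algebra_simps)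
  then show ?thesis using p by (simp add: powr_def exp_add)
qed (use assms in auto)

text \<open>The superlevel sets of the dominating Gaussian are intervals, so no Brunn--Minkowski
  inequality is required.\<close>

lemma prekopa_leindler_std_normal:
  fixes u v :: "real \<Rightarrow> real" and t \<kappa> C :: real
  assumes t: "0 < t" "t < 1" and [measurable]: "u \<in> borel_measurable borel" "v \<in> borel_measurable borel"
    and u: "\<And>x. 0 < u x" "\<And>x. u x \<le> C" and v: "\<And>x. 0 < v x" "\<And>x. v x \<le> C"
    and uv: "\<And>x y. u x powr t * v y powr (1 - t) \<le> \<kappa> * exp (t * (1 - t) / 2 * (x - y)\<^sup>2)"
  shows "(\<integral>x. u x \<partial>density lborel (normal_density 0 1)) powr t *
         (\<integral>x. v x \<partial>density lborel (normal_density 0 1)) powr (1 - t) \<le> \<kappa>"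
proof -
  define \<phi> :: "real \<Rightarrow> real" where "\<phi> = std_normal_density"
  have \<phi>_meas[measurable]: "\<phi> \<in> borel_measurable borel" unfolding \<phi>_def by simp
  have \<phi>_pos: "\<phi> x > 0" for x unfolding \<phi>_def by (simp add: normal_density_pos)
  define c0 where "c0 = 1 / sqrt (2 * pi)"
  have c0: "c0 > 0" unfolding c0_def by simp
  have \<phi>_eq: "\<phi> x = c0 * exp (- x\<^sup>2 / 2)" for x
    unfolding \<phi>_def c0_def by (simp add: std_normal_density_def)
  have \<phi>_le: "\<phi> x \<le> c0" for x unfolding \<phi>_eq using c0 by simp
  have C: "C > 0" using u(1)[of 0] u(2)[of 0] by linarith
  define F G where "F = (\<lambda>x. u x * \<phi> x)" and "G = (\<lambda>x. v x * \<phi> x)"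
  have [measurable]: "F \<in> borel_measurable borel" "G \<in> borel_measurable borel"
    unfolding F_def G_def by measurable
  have Fpos: "F x > 0" and Gpos: "G x > 0" for x unfolding F_def G_def using u v \<phi>_pos by simp_all
  have Fle: "F x \<le> C * c0" and Gle: "G x \<le> C * c0" for x
    unfolding F_def G_def using u[of x] v[of x] \<phi>_pos[of x] \<phi>_le[of x] by (intro mult_mono; simp add: less_imp_le)+
  \<comment> \<open>Divided by its supremum, each function has superlevel sets that are nonempty
    exactly for s < 1. Without this common range one of the two sets could be empty while the other
    is not, and \<open>weighted_emeasure_le_interval\<close> would not apply.\<close>
  define P Q where "P = Sup (range F)" and "Q = Sup (range G)"
  have bF: "bdd_above (range F)" and bG: "bdd_above (range G)" using Fle Gle by (auto simp: bdd_above_def)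
  have FP: "F x \<le> P" and GQ: "G x \<le> Q" for x unfolding P_def Q_def by (intro cSup_upper; simp add: bF bG)+
  have P: "P > 0" and Q: "Q > 0" using Fpos[of 0] FP[of 0] Gpos[of 0] GQ[of 0] by linarith+
  have \<kappa>: "\<kappa> > 0"
  proof -
    have "0 < u 0 powr t * v 0 powr (1 - t)" using u(1)[of 0] v(1)[of 0] by simp
    also have "\<dots> \<le> \<kappa>" using uv[of 0 0] by simp
    finally show ?thesis .
  qed
  define D where "D = \<kappa> / (P powr t * Q powr (1 - t))"
  have D: "D > 0" unfolding D_def using \<kappa> P Q by simp
  have key: "(F x / P) powr t * (G y / Q) powr (1 - t) \<le> D * \<phi> (t * x + (1 - t) * y)" for x y
  proof -
    \<comment> \<open>This is t x^2 + (1 - t) y^2 - t (1 - t) (x - y)^2 = (t x + (1 - t) y)^2, the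
      source of the exponent in \<open>uv\<close>.\<close>
    have ex: "exp (- x\<^sup>2 / 2) powr t * exp (- y\<^sup>2 / 2) powr (1 - t) * exp (t * (1 - t) / 2 * (x - y)\<^sup>2)
        = exp (- (t * x + (1 - t) * y)\<^sup>2 / 2)"
      unfolding powr_def exp_add[symmetric]
      by (simp add: exp_add[symmetric]) (simp add: field_simps power2_eq_square)
    have "c0 powr t * c0 powr (1 - t) = c0" using c0 by (simp add: powr_add[symmetric])
    have "F x powr t * G y powr (1 - t) = (u x powr t * v y powr (1 - t)) *
        ((c0 powr t * c0 powr (1 - t)) * (exp (- x\<^sup>2 / 2) powr t * exp (- y\<^sup>2 / 2) powr (1 - t)))"
      unfolding F_def G_def \<phi>_eq using u(1)[of x] v(1)[of y] c0
      by (simp add: powr_mult less_imp_le mult_ac)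
    also have "\<dots> \<le> (\<kappa> * exp (t * (1 - t) / 2 * (x - y)\<^sup>2)) *
        ((c0 powr t * c0 powr (1 - t)) * (exp (- x\<^sup>2 / 2) powr t * exp (- y\<^sup>2 / 2) powr (1 - t)))"
      by (intro mult_right_mono uv) auto
    also have "\<dots> = \<kappa> * (c0 * (exp (- x\<^sup>2 / 2) powr t * exp (- y\<^sup>2 / 2) powr (1 - t) * exp (t * (1 - t) / 2 * (x - y)\<^sup>2)))"
      unfolding \<open>c0 powr t * c0 powr (1 - t) = c0\<close> by (simp add: mult_ac)
    also have "\<dots> = \<kappa> * \<phi> (t * x + (1 - t) * y)" unfolding ex \<phi>_eq ..
    finally have "F x powr t * G y powr (1 - t) \<le> \<kappa> * \<phi> (t * x + (1 - t) * y)" .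
    then have "F x powr t * G y powr (1 - t) / (P powr t * Q powr (1 - t)) \<le> \<kappa> * \<phi> (t * x + (1 - t) * y) / (P powr t * Q powr (1 - t))"
      by (intro divide_right_mono) auto
    then show ?thesis using P Q Fpos[of x] Gpos[of y] unfolding D_def by (simp add: powr_divide less_imp_le)
  qed
  define f g h where "f = (\<lambda>x. F x / P)" and "g = (\<lambda>x. G x / Q)" and "h = (\<lambda>x. D * \<phi> x)"
  have [measurable]: "f \<in> borel_measurable borel" "g \<in> borel_measurable borel" "h \<in> borel_measurable borel"
    unfolding f_def g_def h_def by measurable
  have fgpos: "f x > 0" "g x > 0" "f x \<le> 1" "g x \<le> 1" for x
    unfolding f_def g_def using Fpos Gpos P Q FP GQ by (simp_all add: field_simps)
  have level: "ennreal t * emeasure lborel {x. s < f x} + ennreal (1 - t) * emeasure lborel {x. s < g x} \<le> emeasure lborel {x. s < h x}"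
    if s: "0 < s" for s
  proof (cases "s < 1")
    case False
    then have "f x \<le> s" "g x \<le> s" for x using fgpos[of x] by linarith+
    then have "{x. s < f x} = {}" "{x. s < g x} = {}" by (auto simp: not_less)
    then show ?thesis by simp
  next
    case True
    have "s * P < P" "s * Q < Q" using True P Q by simp_all
    then obtain x0 y0 where "s * P < F x0" "s * Q < G y0"
      unfolding P_def Q_def using less_cSup_iff[of "range F"] less_cSup_iff[of "range G"] bF bG by auto
    then have ne: "{x. s < f x} \<noteq> {}" "{x. s < g x} \<noteq> {}"
      unfolding f_def g_def using P Q by (auto simp: field_simps)
    have inh: "s < h (t * a + (1 - t) * b)" if "s < f a" "s < g b" for a b
    proof -
      have "s = s powr t * s powr (1 - t)" using s by (simp add: powr_add[symmetric])
      also have "\<dots> < f a powr t * g b powr (1 - t)"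
        using s that t by (intro mult_strict_mono powr_less_mono2) auto
      also have "\<dots> \<le> h (t * a + (1 - t) * b)" unfolding f_def g_def h_def by (rule key)
      finally show ?thesis .
    qed
    define q where "q = 2 * ln (D * c0 / s)"
    have hq: "s < h x \<longleftrightarrow> x\<^sup>2 < q" for x
    proof -
      have "s < h x \<longleftrightarrow> s / (D * c0) < exp (- x\<^sup>2 / 2)"
        unfolding h_def \<phi>_eq using D c0 by (simp add: field_simps)
      also have "\<dots> \<longleftrightarrow> ln (s / (D * c0)) < - x\<^sup>2 / 2"
        using s D c0 by (subst ln_less_cancel_iff[symmetric]) auto
      also have "\<dots> \<longleftrightarrow> x\<^sup>2 < q" unfolding q_def using s D c0 by (simp add: ln_div) linarith
      finally show ?thesis .
    qed
    obtain z where "s < h z" using ne inh by blast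
    then have "q > 0" unfolding hq using zero_le_power2[of z] by linarith
    have hint: "s < h x \<longleftrightarrow> \<bar>x\<bar> < sqrt q" for x unfolding hq
      by (metis real_sqrt_abs real_sqrt_less_iff)
    have "ennreal t * emeasure lborel {x. s < f x} + ennreal (1 - t) * emeasure lborel {x. s < g x} \<le> ennreal (2 * sqrt q)"
    proof (rule weighted_emeasure_le_interval[OF t ne])
      show "\<bar>t * a + (1 - t) * b\<bar> \<le> sqrt q" if "a \<in> {x. s < f x}" "b \<in> {x. s < g x}" for a b
        using inh[of a b] that unfolding hint by auto
    qed
    also have "{x. s < h x} = {- sqrt q <..< sqrt q}" unfolding hint by auto
    then have "ennreal (2 * sqrt q) = emeasure lborel {x. s < h x}" using \<open>q > 0\<close> by simp
    finally show ?thesis .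
  qed
  have lc: "(\<integral>\<^sup>+x. ennreal (w x) \<partial>lborel) = (\<integral>\<^sup>+s. indicator {0..} s * emeasure lborel {x. s < w x} \<partial>lborel)"
    if "w \<in> borel_measurable borel" for w :: "real \<Rightarrow> real"
    using nn_integral_layer_cake[OF sigma_finite_lborel, of w] that by simp
  have "ennreal t * (\<integral>\<^sup>+x. ennreal (f x) \<partial>lborel) + ennreal (1 - t) * (\<integral>\<^sup>+x. ennreal (g x) \<partial>lborel)
     = (\<integral>\<^sup>+s. indicator {0..} s * (ennreal t * emeasure lborel {x. s < f x} + ennreal (1 - t) * emeasure lborel {x. s < g x}) \<partial>lborel)"
    by (simp add: lc nn_integral_cmult[symmetric] nn_integral_add[symmetric] distrib_left mult_ac)
  also have "\<dots> \<le> (\<integral>\<^sup>+s. indicator {0..} s * emeasure lborel {x. s < h x} \<partial>lborel)"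
  proof (rule nn_integral_mono_AE)
    have "AE s in lborel. s \<noteq> (0::real)" by (rule AE_lborel_singleton)
    then show "AE s in lborel. indicator {0..} s * (ennreal t * emeasure lborel {x. s < f x} + ennreal (1 - t) * emeasure lborel {x. s < g x})
        \<le> indicator {0..} s * emeasure lborel {x. s < h x}"
      by eventually_elim (use level in \<open>auto simp: indicator_def\<close>)
  qed
  also have "\<dots> = (\<integral>\<^sup>+x. ennreal (h x) \<partial>lborel)" by (simp add: lc)
  also have "\<dots> = ennreal D * (\<integral>\<^sup>+x. ennreal (\<phi> x) \<partial>lborel)"
    unfolding h_def using D \<phi>_pos by (simp add: ennreal_mult less_imp_le nn_integral_cmult)
  also have "(\<integral>\<^sup>+x. ennreal (\<phi> x) \<partial>lborel) = 1"
    unfolding \<phi>_def using nn_integral_eq_integral[of lborel "std_normal_density"] by (simp add: integrable_normal_density)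
  finally have main: "ennreal t * (\<integral>\<^sup>+x. ennreal (f x) \<partial>lborel) + ennreal (1 - t) * (\<integral>\<^sup>+x. ennreal (g x) \<partial>lborel) \<le> ennreal D"
    by simp
  have int\<phi>: "integrable lborel \<phi>" unfolding \<phi>_def by (rule integrable_normal_density) simp
  have intF: "integrable lborel F" and intG: "integrable lborel G"
    unfolding F_def G_def using u v \<phi>_pos
    by (auto intro!: Bochner_Integration.integrable_bound[OF integrable_mult_right[OF int\<phi>, of C]] mult_mono simp: less_imp_le C abs_mult)
  have nnf: "(\<integral>\<^sup>+x. ennreal (f x) \<partial>lborel) = ennreal ((\<integral>x. F x \<partial>lborel) / P)"
    using nn_integral_eq_integral[of lborel f] intF fgpos unfolding f_def by (simp add: less_imp_le)
  have nng: "(\<integral>\<^sup>+x. ennreal (g x) \<partial>lborel) = ennreal ((\<integral>x. G x \<partial>lborel) / Q)"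
    using nn_integral_eq_integral[of lborel g] intG fgpos unfolding g_def by (simp add: less_imp_le)
  define a b where "a = (\<integral>x. F x \<partial>lborel)" and "b = (\<integral>x. G x \<partial>lborel)"
  have ab: "a \<ge> 0" "b \<ge> 0" unfolding a_def b_def using Fpos Gpos by (auto intro!: Bochner_Integration.integral_nonneg simp: less_imp_le)
  have "ennreal (t * (a / P) + (1 - t) * (b / Q)) \<le> ennreal D"
    using main t ab P Q unfolding nnf nng a_def[symmetric] b_def[symmetric]
    by (simp add: ennreal_mult[symmetric] ennreal_plus[symmetric] del: ennreal_plus)
  then have "t * (a / P) + (1 - t) * (b / Q) \<le> D" using D by simp
  \<comment> \<open>The layer-cake argument bounds a weighted arithmetic mean. Passing to the
    geometric mean makes the bound homogeneous, and P and Q then cancel against the denominator of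
    D.\<close>
  moreover have "(a / P) powr t * (b / Q) powr (1 - t) \<le> t * (a / P) + (1 - t) * (b / Q)"
    using t ab P Q by (intro weighted_am_gm) auto
  ultimately have "(a / P) powr t * (b / Q) powr (1 - t) \<le> \<kappa> / (P powr t * Q powr (1 - t))"
    unfolding D_def by linarith
  then have "a powr t * b powr (1 - t) \<le> \<kappa>"
    using ab P Q by (simp add: powr_divide field_simps)
  moreover have "(\<integral>x. u x \<partial>density lborel (normal_density 0 1)) = a"
    unfolding a_def F_def \<phi>_def by (subst integral_density) (auto simp: mult_ac)
  moreover have "(\<integral>x. v x \<partial>density lborel (normal_density 0 1)) = b"
    unfolding b_def G_def \<phi>_def by (subst integral_density) (auto simp: mult_ac)
  ultimately show ?thesis by simp
qed

section \<open>Tensorization to product measures\<close>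

lemma prob_space_std_normal: "prob_space (density lborel (\<lambda>x. ennreal (normal_density 0 1 x)))"
  by (rule prob_space_normal_density) simp

lemma integrable_bounded_positive:
  fixes f :: "'a \<Rightarrow> real"
  assumes "finite_measure M" "f \<in> borel_measurable M" "\<And>x. x \<in> space M \<Longrightarrow> 0 < f x \<and> f x \<le> C"
  shows "integrable M f"
proof -
  interpret finite_measure M by fact
  show ?thesis using assms by (intro integrable_const_bound[where B = C] AE_I2) fastforce+
qed

lemma integral_between:
  fixes f :: "'a \<Rightarrow> real"
  assumes "prob_space M" "f \<in> borel_measurable M" "\<And>x. x \<in> space M \<Longrightarrow> c \<le> f x \<and> f x \<le> C"
  shows "c \<le> (\<integral>x. f x \<partial>M)" "(\<integral>x. f x \<partial>M) \<le> C"
proof -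
  interpret prob_space M by fact
  have bd: "norm (f x) \<le> \<bar>c\<bar> + \<bar>C\<bar>" if "x \<in> space M" for x using assms(3)[OF that] by (auto simp: abs_le_iff)
  have "integrable M f" using assms bd by (intro integrable_const_bound[where B = "\<bar>c\<bar> + \<bar>C\<bar>"] AE_I2) auto
  then show "c \<le> (\<integral>x. f x \<partial>M)" "(\<integral>x. f x \<partial>M) \<le> C"
    using assms(3) by (auto intro!: integral_ge_const integral_le_const AE_I2)
qed

lemma prekopa_leindler_std_normal_PiM:
  fixes u v :: "('i \<Rightarrow> real) \<Rightarrow> real" and t c C :: real
  defines "\<gamma> \<equiv> density lborel (\<lambda>x. ennreal (normal_density 0 1 x))"
  assumes "finite I" and t: "0 < t" "t < 1" and c: "0 < c"
    and "u \<in> borel_measurable (PiM I (\<lambda>_. \<gamma>))" "v \<in> borel_measurable (PiM I (\<lambda>_. \<gamma>))"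
    and "\<And>x. x \<in> space (PiM I (\<lambda>_. \<gamma>)) \<Longrightarrow> c \<le> u x \<and> u x \<le> C"
    and "\<And>x. x \<in> space (PiM I (\<lambda>_. \<gamma>)) \<Longrightarrow> c \<le> v x \<and> v x \<le> C"
    and "\<And>x y. x \<in> space (PiM I (\<lambda>_. \<gamma>)) \<Longrightarrow> y \<in> space (PiM I (\<lambda>_. \<gamma>)) \<Longrightarrow>
           u x powr t * v y powr (1 - t) \<le> exp (t * (1 - t) / 2 * (\<Sum>i\<in>I. (x i - y i)\<^sup>2))"
  shows "(\<integral>x. u x \<partial>PiM I (\<lambda>_. \<gamma>)) powr t * (\<integral>x. v x \<partial>PiM I (\<lambda>_. \<gamma>)) powr (1 - t) \<le> 1"
  using assms(2,6-)
proof (induction I arbitrary: u v rule: finite_induct)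
  case empty
  interpret product_sigma_finite "\<lambda>_. \<gamma>"
    unfolding product_sigma_finite_def \<gamma>_def using prob_space_std_normal prob_space_imp_sigma_finite by blast
  show ?case using empty.prems(5)[of "\<lambda>_. undefined" "\<lambda>_. undefined"]
    by (simp add: PiM_empty lebesgue_integral_count_space_finite space_PiM)
next
  case (insert i I)
  have prob: "prob_space \<gamma>" unfolding \<gamma>_def by (rule prob_space_std_normal)
  interpret product_sigma_finite "\<lambda>_. \<gamma>"
    unfolding product_sigma_finite_def using prob prob_space_imp_sigma_finite by blast
  interpret G: prob_space \<gamma> by fact
  have sets\<gamma>: "sets \<gamma> = sets borel" "space \<gamma> = UNIV" unfolding \<gamma>_def by simp_all
  have PI: "prob_space (PiM J (\<lambda>_. \<gamma>))" for J :: "'i set" by (intro prob_space_PiM prob)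
  note u_m[measurable] = insert.prems(1) and v_m[measurable] = insert.prems(2)
  have upd: "x(i := s) \<in> space (PiM (insert i I) (\<lambda>_. \<gamma>))" if "x \<in> space (PiM I (\<lambda>_. \<gamma>))" for x s
    using that by (auto simp: space_PiM sets\<gamma> PiE_iff extensional_def split: if_splits)
  define U V where "U = (\<lambda>x. \<integral>s. u (x(i := s)) \<partial>\<gamma>)" and "V = (\<lambda>x. \<integral>s. v (x(i := s)) \<partial>\<gamma>)"
  have [measurable]: "(\<lambda>s. u (x(i := s))) \<in> borel_measurable \<gamma>" "(\<lambda>s. v (x(i := s))) \<in> borel_measurable \<gamma>"
    if "x \<in> space (PiM I (\<lambda>_. \<gamma>))" for x
    using measurable_comp[OF measurable_component_update u_m, OF that insert.hyps(2)]
      measurable_comp[OF measurable_component_update v_m, OF that insert.hyps(2)] unfolding comp_def by simp_all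
  have U_m: "U \<in> borel_measurable (PiM I (\<lambda>_. \<gamma>))" and V_m: "V \<in> borel_measurable (PiM I (\<lambda>_. \<gamma>))"
    unfolding U_def V_def by measurable
  have Ub: "c \<le> U x \<and> U x \<le> C" and Vb: "c \<le> V x \<and> V x \<le> C" if x: "x \<in> space (PiM I (\<lambda>_. \<gamma>))" for x
    unfolding U_def V_def
    using integral_between[OF prob, of "\<lambda>s. u (x(i := s))" c C] integral_between[OF prob, of "\<lambda>s. v (x(i := s))" c C]
      insert.prems(3,4)[OF upd[OF x]] x by simp_all
  have UV: "U x powr t * V y powr (1 - t) \<le> exp (t * (1 - t) / 2 * (\<Sum>i\<in>I. (x i - y i)\<^sup>2))"
    if x: "x \<in> space (PiM I (\<lambda>_. \<gamma>))" and y: "y \<in> space (PiM I (\<lambda>_. \<gamma>))" for x y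
    unfolding U_def V_def \<gamma>_def
  proof (rule prekopa_leindler_std_normal[OF t])
    show "(\<lambda>s. u (x(i := s))) \<in> borel_measurable borel" "(\<lambda>s. v (y(i := s))) \<in> borel_measurable borel"
      using x y by (simp_all add: measurable_cong_sets[OF sets\<gamma>(1)[symmetric] refl])
    fix s r
    show "0 < u (x(i := s))" "u (x(i := s)) \<le> C" "0 < v (y(i := s))" "v (y(i := s)) \<le> C"
      using insert.prems(3)[OF upd[OF x, of s]] insert.prems(4)[OF upd[OF y, of s]] c
      by (auto simp: fun_upd_def)
    have "(\<Sum>j\<in>insert i I. ((x(i := s)) j - (y(i := r)) j)\<^sup>2) = (s - r)\<^sup>2 + (\<Sum>j\<in>I. (x j - y j)\<^sup>2)"
      using insert.hyps by (auto intro!: sum.cong)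
    then show "u (x(i := s)) powr t * v (y(i := r)) powr (1 - t)
        \<le> exp (t * (1 - t) / 2 * (\<Sum>i\<in>I. (x i - y i)\<^sup>2)) * exp (t * (1 - t) / 2 * (s - r)\<^sup>2)"
      using insert.prems(5)[OF upd[OF x, of s] upd[OF y, of r]]
      by (simp add: exp_add[symmetric] algebra_simps fun_upd_def)
  qed
  have iu: "integrable (PiM (insert i I) (\<lambda>_. \<gamma>)) u" "integrable (PiM (insert i I) (\<lambda>_. \<gamma>)) v"
    using insert.prems(3,4) c
    by (fastforce intro!: integrable_bounded_positive[of _ _ C] prob_space.finite_measure[OF PI])+
  have "(\<integral>x. u x \<partial>PiM (insert i I) (\<lambda>_. \<gamma>)) = (\<integral>x. U x \<partial>PiM I (\<lambda>_. \<gamma>))"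
    "(\<integral>x. v x \<partial>PiM (insert i I) (\<lambda>_. \<gamma>)) = (\<integral>x. V x \<partial>PiM I (\<lambda>_. \<gamma>))"
    unfolding U_def V_def using insert.hyps iu by (simp_all add: product_integral_insert)
  moreover have "(\<integral>x. U x \<partial>PiM I (\<lambda>_. \<gamma>)) powr t * (\<integral>x. V x \<partial>PiM I (\<lambda>_. \<gamma>)) powr (1 - t) \<le> 1"
    by (rule insert.IH[OF U_m V_m Ub Vb UV])
  ultimately show ?case by simp
qed

text \<open>Jensen for exp, by integrating its tangent line at the mean.\<close>

lemma exp_expectation_le:
  fixes g :: "'a \<Rightarrow> real"
  assumes "prob_space M" "integrable M g" "integrable M (\<lambda>x. exp (g x))"
  shows "exp (\<integral>x. g x \<partial>M) \<le> (\<integral>x. exp (g x) \<partial>M)"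
proof -
  interpret prob_space M by fact
  define a where "a = (\<integral>x. g x \<partial>M)"
  have "exp a * (1 + (g x - a)) \<le> exp (g x)" for x
    using exp_ge_add_one_self[where x = "g x - a"] mult_left_mono[of "1 + (g x - a)" "exp (g x - a)" "exp a"]
    by (simp add: exp_add[symmetric])
  then have "(\<integral>x. exp a * (1 + (g x - a)) \<partial>M) \<le> (\<integral>x. exp (g x) \<partial>M)"
    using assms by (intro integral_mono) auto
  also have "(\<integral>x. exp a * (1 + (g x - a)) \<partial>M) = exp a"
    using assms(2) by (simp add: a_def prob_space)
  finally show ?thesis unfolding a_def .
qed

text \<open>Boundedness of g keeps both exponential test functions between positive constants, as
  the tensorized inequality demands. The spectral norm is brought into this form by truncation in
  \<open>spectral_norm_concentration\<close>.\<close>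

theorem gaussian_concentration:
  fixes g :: "('i \<Rightarrow> real) \<Rightarrow> real"
  defines "M \<equiv> PiM UNIV (\<lambda>_. density lborel (\<lambda>x. ennreal (normal_density 0 1 x)))"
  assumes fin: "finite (UNIV :: 'i set)" and g_m: "g \<in> borel_measurable M"
    and gb: "\<And>x. 0 \<le> g x \<and> g x \<le> K"
    and lip: "\<And>x y. \<bar>g x - g y\<bar> \<le> sqrt (\<Sum>i\<in>UNIV. (x i - y i)\<^sup>2)"
    and s: "0 \<le> s"
  shows "measure M {x. (\<integral>x. g x \<partial>M) + s \<le> g x} \<le> exp (- s\<^sup>2 / 2)"
proof (cases "s = 0")
  case True
  interpret prob_space M unfolding M_def by (intro prob_space_PiM prob_space_std_normal)
  show ?thesis using True by simp
next
  case False
  interpret prob_space M unfolding M_def by (intro prob_space_PiM prob_space_std_normal)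
  have spM: "space M = UNIV" unfolding M_def by (auto simp: space_PiM)
  note g_m[measurable]
  have K: "0 \<le> K" using gb[of undefined] by linarith
  have ig: "integrable M g" using gb by (intro integrable_const_bound[where B = K] AE_I2) auto
  define m where "m = (\<integral>x. g x \<partial>M)"
  have bound: "measure M {x. m + s \<le> g x} \<le> exp (- (1 - t) * s\<^sup>2 / 2)" if t: "0 < t" "t < 1" for t
  proof -
    \<comment> \<open>For fixed t the Chernoff exponent is L^2 / (2 (1 - t)) - L s, least at L = s
      (1 - t). The value of \<epsilon> makes v^(1-t) equal to exp (- t L g), so that u^t v^(1-t)
      involves only the difference of two values of g.\<close>
    define L \<epsilon> where "L = s * (1 - t)" and "\<epsilon> = t / (1 - t)"
    have L: "L > 0" and \<epsilon>: "\<epsilon> > 0" unfolding L_def \<epsilon>_def using s False t by auto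
    define u v where "u = (\<lambda>x. exp (L * g x - L\<^sup>2 / (2 * (1 - t))))" and "v = (\<lambda>x. exp (- \<epsilon> * L * g x))"
    have [measurable]: "u \<in> borel_measurable M" "v \<in> borel_measurable M" unfolding u_def v_def by measurable
    define b where "b = L * K + L\<^sup>2 / (2 * (1 - t)) + \<epsilon> * L * K"
    have nn: "0 \<le> L * g x" "L * g x \<le> L * K" "0 \<le> \<epsilon> * L * g x" "\<epsilon> * L * g x \<le> \<epsilon> * L * K" for x
      using gb[of x] L \<epsilon> K t by (auto intro!: mult_nonneg_nonneg mult_left_mono)
    have nn': "0 \<le> L\<^sup>2 / (2 * (1 - t))" "0 \<le> \<epsilon> * L * K" "0 \<le> L * K"
      using L \<epsilon> K t by (auto intro!: mult_nonneg_nonneg)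
    have ub: "exp (- b) \<le> u x \<and> u x \<le> exp b" and vb: "exp (- b) \<le> v x \<and> v x \<le> exp b" for x
      using nn[of x] nn' unfolding u_def v_def b_def by auto
    have "(\<integral>x. u x \<partial>M) powr t * (\<integral>x. v x \<partial>M) powr (1 - t) \<le> 1"
      unfolding M_def
    proof (rule prekopa_leindler_std_normal_PiM[OF fin t, of "exp (- b)" _ _ "exp b"], goal_cases)
      case (6 x y)
      define d where "d = sqrt (\<Sum>i\<in>UNIV. (x i - y i)\<^sup>2)"
      have d2: "(\<Sum>i\<in>UNIV. (x i - y i)\<^sup>2) = d\<^sup>2" unfolding d_def by (simp add: sum_nonneg)
      have "L * (g x - g y) \<le> L * d" using lip[of x y] L unfolding d_def by (intro mult_left_mono) auto
      \<comment> \<open>Young's inequality explains the constant subtracted in the exponent of u: it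
        absorbs the Lipschitz term up to the permitted quadratic.\<close>
      also have "\<dots> \<le> L\<^sup>2 / (2 * (1 - t)) + (1 - t) / 2 * d\<^sup>2"
      proof -
        have "0 \<le> (L - (1 - t) * d)\<^sup>2 / (2 * (1 - t))" using t by simp
        also have "\<dots> = L\<^sup>2 / (2 * (1 - t)) + (1 - t) / 2 * d\<^sup>2 - L * d"
          using t by (simp add: field_simps power2_eq_square)
        finally show ?thesis by simp
      qed
      finally have "L * (g x - g y) - L\<^sup>2 / (2 * (1 - t)) \<le> (1 - t) / 2 * d\<^sup>2" by simp
      then have "t * (L * (g x - g y) - L\<^sup>2 / (2 * (1 - t))) \<le> t * ((1 - t) / 2 * d\<^sup>2)"
        using t by (intro mult_left_mono) auto
      moreover have "u x powr t * v y powr (1 - t) = exp (t * (L * (g x - g y) - L\<^sup>2 / (2 * (1 - t))))"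
        unfolding u_def v_def \<epsilon>_def powr_def using t by (simp add: exp_add[symmetric]) (simp add: field_simps)
      ultimately show ?case unfolding d2 by simp
    qed (use ub vb in \<open>auto simp flip: M_def\<close>)
    then have P1: "(\<integral>x. u x \<partial>M) powr t * (\<integral>x. v x \<partial>M) powr (1 - t) \<le> 1" .
    have iu: "integrable M u" and iv: "integrable M v"
      using ub vb by (auto intro!: integrable_const_bound[where B = "exp b"] AE_I2 simp: u_def v_def)
    \<comment> \<open>Jensen bounds the v-factor from below. The product inequality thereby becomes
      E u <= exp (L m), an exponential moment bound about the mean rather than the median.\<close>
    have "exp (\<integral>x. - \<epsilon> * L * g x \<partial>M) \<le> (\<integral>x. v x \<partial>M)"
      unfolding v_def using ig iv[unfolded v_def] by (intro exp_expectation_le) (auto simp: prob_space_axioms)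
    then have vl: "exp (- \<epsilon> * L * m) \<le> (\<integral>x. v x \<partial>M)" unfolding m_def using ig by simp
    have up: "(\<integral>x. u x \<partial>M) \<ge> exp (- b)" using integral_between(1)[OF prob_space_axioms _ ub] by simp
    then have upos: "(\<integral>x. u x \<partial>M) > 0" using exp_gt_zero[of "- b"] by linarith
    have "(\<integral>x. u x \<partial>M) powr t * exp (- \<epsilon> * L * m) powr (1 - t) \<le> (\<integral>x. u x \<partial>M) powr t * (\<integral>x. v x \<partial>M) powr (1 - t)"
      using t vl by (intro mult_left_mono powr_mono2) auto
    with P1 have "(\<integral>x. u x \<partial>M) powr t * exp (- \<epsilon> * L * m) powr (1 - t) \<le> 1" by simp
    then have "exp (t * ln (\<integral>x. u x \<partial>M) + - t * (L * m)) \<le> 1"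
      using upos t unfolding powr_def \<epsilon>_def by (simp add: exp_add[symmetric] mult_ac)
    then have "t * (ln (\<integral>x. u x \<partial>M) - L * m) \<le> 0" by (simp add: algebra_simps)
    then have "ln (\<integral>x. u x \<partial>M) \<le> L * m" using t by (simp add: mult_le_0_iff)
    then have E: "(\<integral>x. u x \<partial>M) \<le> exp (L * m)" using upos by (metis exp_ln exp_le_cancel_iff)
    define a where "a = exp (L * (m + s) - L\<^sup>2 / (2 * (1 - t)))"
    have "{x. m + s \<le> g x} = {x \<in> space M. a \<le> u x}" unfolding a_def u_def spM using L by auto
    then have "measure M {x. m + s \<le> g x} \<le> (\<integral>x. u x \<partial>M) / a"
      using integral_Markov_inequality_measure[OF iu, of "space M" a] by (simp add: a_def u_def)
    also have "\<dots> \<le> exp (L * m) / a" using E by (simp add: a_def divide_right_mono)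
    also have "\<dots> = exp (- (1 - t) * s\<^sup>2 / 2)"
      unfolding a_def L_def exp_diff[symmetric] using t by (simp add: field_simps power2_eq_square)
    finally show ?thesis .
  qed
  have "((\<lambda>t. exp (- (1 - t) * s\<^sup>2 / 2)) \<longlongrightarrow> exp (- (1 - 0) * s\<^sup>2 / 2)) (at_right 0)"
    by (intro tendsto_intros) auto
  then have "measure M {x. m + s \<le> g x} \<le> exp (- (1 - 0) * s\<^sup>2 / 2)"
  proof (rule tendsto_lowerbound)
    show "\<forall>\<^sub>F t in at_right 0. measure M {x. m + s \<le> g x} \<le> exp (- (1 - t) * s\<^sup>2 / 2)"
      unfolding eventually_at_right_field by (intro exI[of _ 1] conjI zero_less_one allI impI bound)
  qed simp
  then show ?thesis unfolding m_def by simp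
qed

section \<open>Gaussian measures on Euclidean spaces\<close>

lemma lborel_distr_minus_left:
  fixes c :: "'a::euclidean_space"
  shows "distr lborel borel (\<lambda>x. c - x) = lborel"
  using lborel_affine[of "-1" c] by (simp add: density_1)

text \<open>Uniqueness of Haar measure: by translation invariance of both factors,
  \<open>\<integral>\<integral> 1\<^sub>A(x) 1\<^sub>B(x + y)\<close> equals both \<open>M A * lborel B\<close> and \<open>M B * lborel A\<close>.\<close>

lemma translation_invariant_eq_lborel:
  fixes M :: "'a::euclidean_space measure"
  assumes sf: "sigma_finite_measure M" and sM: "sets M = sets borel"
    and tr: "\<And>c. distr M borel ((+) c) = M"
    and B: "B \<in> sets borel" "emeasure M B = emeasure lborel B" "emeasure lborel B \<noteq> 0" "emeasure lborel B \<noteq> \<infinity>"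
  shows "M = lborel"
proof (rule measure_eqI)
  fix A assume "A \<in> sets M"
  then have A[measurable]: "A \<in> sets borel" using sM by simp
  note B(1)[measurable] and sM[measurable_cong]
  interpret M: sigma_finite_measure M by fact
  interpret P: pair_sigma_finite M lborel ..
  have tr_lb: "(\<integral>\<^sup>+y. indicator B (x + y) \<partial>lborel) = emeasure lborel B" for x :: 'a
  proof -
    have "(\<integral>\<^sup>+y. indicator B y \<partial>distr lborel borel ((+) x)) = (\<integral>\<^sup>+y. indicator B (x + y) \<partial>lborel)"
      by (intro nn_integral_distr) auto
    then show ?thesis by (simp add: lborel_distr_plus)
  qed
  have tr_M: "(\<integral>\<^sup>+x. f (y + x) \<partial>M) = (\<integral>\<^sup>+x. f x \<partial>M)" if "f \<in> borel_measurable borel" for f :: "'a \<Rightarrow> ennreal" and y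
  proof -
    have "(\<integral>\<^sup>+x. f x \<partial>distr M borel ((+) y)) = (\<integral>\<^sup>+x. f (y + x) \<partial>M)"
      using that by (intro nn_integral_distr) auto
    then show ?thesis unfolding tr by simp
  qed
  have refl: "(\<integral>\<^sup>+y. indicator A (x - y) \<partial>lborel) = emeasure lborel A" for x :: 'a
  proof -
    have "(\<integral>\<^sup>+y. indicator A y \<partial>distr lborel borel (\<lambda>y. x - y)) = (\<integral>\<^sup>+y. indicator A (x - y) \<partial>lborel)"
      by (intro nn_integral_distr) auto
    then show ?thesis by (simp add: lborel_distr_minus_left)
  qed
  have "emeasure M A * emeasure lborel B = (\<integral>\<^sup>+x. indicator A x * emeasure lborel B \<partial>M)"
    by (simp add: nn_integral_multc sM)
  also have "\<dots> = (\<integral>\<^sup>+x. (\<integral>\<^sup>+y. indicator A x * indicator B (x + y) \<partial>lborel) \<partial>M)"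
    by (simp add: nn_integral_cmult tr_lb)
  also have "\<dots> = (\<integral>\<^sup>+y. (\<integral>\<^sup>+x. indicator A x * indicator B (x + y) \<partial>M) \<partial>lborel)"
    by (intro P.Fubini'[symmetric]) measurable
  also have "\<dots> = (\<integral>\<^sup>+y. (\<integral>\<^sup>+x. indicator A (x - y) * indicator B x \<partial>M) \<partial>lborel)"
  proof (rule nn_integral_cong)
    fix y :: 'a
    show "(\<integral>\<^sup>+x. indicator A x * indicator B (x + y) \<partial>M) = (\<integral>\<^sup>+x. indicator A (x - y) * indicator B x \<partial>M)"
      using tr_M[of "\<lambda>x. indicator A (x - y) * indicator B x" y] by (simp add: add.commute)
  qed
  also have "\<dots> = (\<integral>\<^sup>+x. (\<integral>\<^sup>+y. indicator A (x - y) * indicator B x \<partial>lborel) \<partial>M)"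
    by (intro P.Fubini') measurable
  also have "\<dots> = (\<integral>\<^sup>+x. emeasure lborel A * indicator B x \<partial>M)"
    by (simp add: nn_integral_multc refl)
  also have "\<dots> = emeasure lborel A * emeasure lborel B"
    by (simp add: nn_integral_cmult sM B(2))
  finally show "emeasure M A = emeasure lborel A"
    using B(3,4) by (metis mult_divide_eq_ennreal infinity_ennreal_def)
qed (simp add: sM)

text \<open>The image measure is translation invariant because translation by f d pulls back to
  translation by d. Balls about 0 are their own preimages, which gives sigma-finiteness and fixes
  the scale on the unit ball.\<close>

lemma lborel_distr_orthogonal:
  fixes f :: "'a::euclidean_space \<Rightarrow> 'a"
  assumes f: "orthogonal_transformation f"
  shows "distr lborel borel f = lborel"
proof (rule translation_invariant_eq_lborel)
  have lf: "linear f" using f by (rule orthogonal_transformation_linear)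
  then have fm[measurable]: "f \<in> borel_measurable borel"
    by (intro borel_measurable_continuous_onI linear_continuous_on linear_conv_bounded_linear[THEN iffD1])
  have nf: "norm (f x) = norm x" for x using f by (simp add: orthogonal_transformation_norm)
  have pre: "f -` cball 0 r = cball 0 r" for r by (auto simp: nf)
  let ?M = "distr lborel borel f"
  show "sets ?M = sets borel" by simp
  have em: "emeasure ?M (cball 0 r) = emeasure lborel (cball (0::'a) r)" for r
    by (subst emeasure_distr) (simp_all add: pre)
  show "sigma_finite_measure ?M"
  proof (unfold_locales, intro exI conjI)
    let ?C = "range (\<lambda>n::nat. cball (0::'a) (real n))"
    show "countable ?C" "?C \<subseteq> sets ?M" by auto
    show "\<Union> ?C = space ?M" by (auto simp: real_arch_simple)
    show "\<forall>a\<in>?C. emeasure ?M a \<noteq> \<infinity>" using em emeasure_lborel_cball_finite by (auto simp: top.not_eq_extremum)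
  qed
  show "distr ?M borel ((+) c) = ?M" for c
  proof -
    obtain d where d: "c = f d" using orthogonal_transformation_surj[OF f] by (metis surjE)
    have "distr ?M borel ((+) c) = distr lborel borel (\<lambda>x. f d + f x)"
      unfolding d by (simp add: distr_distr comp_def)
    also have "(\<lambda>x. f d + f x) = (\<lambda>x. f (d + x))" using lf by (simp add: linear_add)
    also have "distr lborel borel (\<lambda>x. f (d + x)) = distr (distr lborel borel ((+) d)) borel f"
      by (simp add: distr_distr comp_def)
    finally show ?thesis by (simp add: lborel_distr_plus)
  qed
  show "cball (0::'a) 1 \<in> sets borel" by simp
  show "emeasure ?M (cball 0 1) = emeasure lborel (cball (0::'a) 1)" by (rule em)
  show "emeasure lborel (cball (0::'a) 1) \<noteq> 0" "emeasure lborel (cball (0::'a) 1) \<noteq> \<infinity>"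
    by (simp_all add: emeasure_cball unit_ball_vol_pos less_imp_neq[symmetric])
qed

text \<open>The basis is indexed by an arbitrary set so that, through
  \<open>gaussian_eq_distr_PiM\<close>, one statement serves matrix entries indexed by pairs, a
  single row of a matrix, and plain coordinates.\<close>

lemma lborel_eq_distr_PiM_basis:
  fixes e :: "'i \<Rightarrow> 'a::euclidean_space"
  assumes fin: "finite I" and e: "bij_betw e I Basis"
  shows "lborel = distr (PiM I (\<lambda>_. lborel)) borel (\<lambda>g. \<Sum>i\<in>I. g i *\<^sub>R e i)"
proof (rule lborel_eqI)
  interpret product_sigma_finite "\<lambda>_::'i. lborel :: real measure" ..
  have [measurable]: "(\<lambda>g. \<Sum>i\<in>I. g i *\<^sub>R e i) \<in> measurable (PiM I (\<lambda>_. lborel :: real measure)) borel"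
    by measurable
  have ei: "e i \<in> Basis" if "i \<in> I" for i using e that by (auto simp: bij_betw_def)
  have inner_e: "(\<Sum>i\<in>I. g i *\<^sub>R e i) \<bullet> e j = g j" if "j \<in> I" for g j
  proof -
    have "(\<Sum>i\<in>I. g i *\<^sub>R e i) \<bullet> e j = (\<Sum>i\<in>I. if i = j then g i else 0)"
      unfolding inner_sum_left using e that
      by (intro sum.cong refl) (auto simp: inner_Basis ei bij_betw_def inj_on_eq_iff)
    then show ?thesis using that fin by simp
  qed
  fix l u :: 'a assume "\<And>b. b \<in> Basis \<Longrightarrow> l \<bullet> b \<le> u \<bullet> b"
  then have lu: "l \<bullet> e i \<le> u \<bullet> e i" if "i \<in> I" for i using ei that by auto
  have B: "Basis = e ` I" using e by (simp add: bij_betw_def)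
  have "(\<lambda>g. \<Sum>i\<in>I. g i *\<^sub>R e i) -` box l u \<inter> space (PiM I (\<lambda>_. lborel)) = (\<Pi>\<^sub>E i\<in>I. {l \<bullet> e i <..< u \<bullet> e i})"
    by (auto simp: mem_box B space_PiM PiE_iff inner_e)
  then have "emeasure (distr (PiM I (\<lambda>_. lborel)) borel (\<lambda>g. \<Sum>i\<in>I. g i *\<^sub>R e i)) (box l u)
      = (\<Prod>i\<in>I. ennreal (u \<bullet> e i - l \<bullet> e i))"
    using lu fin by (subst emeasure_distr) (simp_all add: emeasure_PiM)
  also have "\<dots> = ennreal (\<Prod>i\<in>I. u \<bullet> e i - l \<bullet> e i)" using lu by (simp add: prod_ennreal)
  also have "(\<Prod>i\<in>I. u \<bullet> e i - l \<bullet> e i) = (\<Prod>b\<in>Basis. (u - l) \<bullet> b)"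
    unfolding inner_diff_left[symmetric]
    using prod.reindex_bij_betw[OF e, of "\<lambda>b. (u - l) \<bullet> b"] by simp
  finally show "emeasure (distr (PiM I (\<lambda>_. lborel)) borel (\<lambda>g. \<Sum>i\<in>I. g i *\<^sub>R e i)) (box l u)
      = (\<Prod>b\<in>Basis. (u - l) \<bullet> b)" .
qed simp

section \<open>Isotropic Gaussian laws: density and product form\<close>

lemma PiM_density:
  fixes f :: "'i \<Rightarrow> 'a \<Rightarrow> ennreal"
  assumes fin: "finite I" and sf: "\<And>i. sigma_finite_measure (M i)" "\<And>i. sigma_finite_measure (density (M i) (f i))"
    and f: "\<And>i. i \<in> I \<Longrightarrow> f i \<in> borel_measurable (M i)"
  shows "PiM I (\<lambda>i. density (M i) (f i)) = density (PiM I M) (\<lambda>x. \<Prod>i\<in>I. f i (x i))"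
proof -
  interpret M: product_sigma_finite M using sf(1) by (simp add: product_sigma_finite_def)
  interpret D: product_sigma_finite "\<lambda>i. density (M i) (f i)" using sf(2) by (simp add: product_sigma_finite_def)
  have fm[measurable]: "(\<lambda>x. \<Prod>i\<in>I. f i (x i)) \<in> borel_measurable (PiM I M)"
  proof (rule borel_measurable_prod_ennreal)
    show "(\<lambda>x. f i (x i)) \<in> borel_measurable (PiM I M)" if "i \<in> I" for i
      using measurable_compose[of "\<lambda>x. x i" "PiM I M" "M i" "f i" borel] measurable_component_singleton[of i I M] f that
      by simp
  qed
  show ?thesis
  proof (rule D.PiM_eqI[symmetric, OF fin])
    show "sets (density (PiM I M) (\<lambda>x. \<Prod>i\<in>I. f i (x i))) = sets (PiM I (\<lambda>i. density (M i) (f i)))"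
      using sets_PiM_cong[of I I M "\<lambda>i. density (M i) (f i)"] by simp
    fix A assume "\<And>i. i \<in> I \<Longrightarrow> A i \<in> sets (density (M i) (f i))"
    then have A: "A i \<in> sets (M i)" if "i \<in> I" for i using that by simp
    have "emeasure (density (PiM I M) (\<lambda>x. \<Prod>i\<in>I. f i (x i))) (Pi\<^sub>E I A)
        = (\<integral>\<^sup>+x. (\<Prod>i\<in>I. f i (x i)) * indicator (Pi\<^sub>E I A) x \<partial>PiM I M)"
      using A fin by (intro emeasure_density fm) auto
    also have "\<dots> = (\<integral>\<^sup>+x. (\<Prod>i\<in>I. f i (x i) * indicator (A i) (x i)) \<partial>PiM I M)"
    proof (intro nn_integral_cong)
      fix x assume "x \<in> space (PiM I M)"
      then have x: "x \<in> extensional I" by (auto simp: space_PiM PiE_def)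
      have "indicator (Pi\<^sub>E I A) x = (\<Prod>i\<in>I. indicator (A i) (x i) :: ennreal)"
        using x fin by (auto simp: indicator_def PiE_iff prod_zero_iff)
      then show "(\<Prod>i\<in>I. f i (x i)) * indicator (Pi\<^sub>E I A) x = (\<Prod>i\<in>I. f i (x i) * indicator (A i) (x i))"
        by (simp add: prod.distrib)
    qed
    also have "\<dots> = (\<Prod>i\<in>I. (\<integral>\<^sup>+x. f i x * indicator (A i) x \<partial>M i))"
      using A f fin by (intro M.product_nn_integral_prod) auto
    also have "\<dots> = (\<Prod>i\<in>I. emeasure (density (M i) (f i)) (A i))"
      using A f by (intro prod.cong refl) (simp add: emeasure_density)
    finally show "emeasure (density (PiM I M) (\<lambda>x. \<Prod>i\<in>I. f i (x i))) (Pi\<^sub>E I A)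
        = (\<Prod>i\<in>I. emeasure (density (M i) (f i)) (A i))" .
  qed
qed

text \<open>A density depending on the distance to the centre alone reduces rotation invariance to
  that of Lebesgue measure; the product form comes back in \<open>gaussian_eq_distr_PiM\<close>. On
  matrices the norm is the Frobenius norm.\<close>

definition gaussian :: "'a::euclidean_space \<Rightarrow> real \<Rightarrow> 'a measure" where
  "gaussian c s = density lborel
     (\<lambda>x. ennreal ((1 / sqrt (2 * pi * s\<^sup>2)) ^ DIM('a) * exp (- (norm (x - c))\<^sup>2 / (2 * s\<^sup>2))))"

lemma sets_gaussian [simp, measurable_cong]: "sets (gaussian c s) = sets borel"
  and space_gaussian [simp]: "space (gaussian c s) = UNIV"
  by (simp_all add: gaussian_def)

lemma prod_normal_density:
  fixes e :: "'i \<Rightarrow> 'a::euclidean_space"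
  assumes "finite I" and e: "bij_betw e I Basis"
  shows "(\<Prod>i\<in>I. normal_density (c \<bullet> e i) s (x \<bullet> e i))
    = (1 / sqrt (2 * pi * s\<^sup>2)) ^ DIM('a) * exp (- (norm (x - c))\<^sup>2 / (2 * s\<^sup>2))"
proof -
  have "(\<Sum>i\<in>I. (x \<bullet> e i - c \<bullet> e i)\<^sup>2) = (\<Sum>b\<in>Basis. ((x - c) \<bullet> b)\<^sup>2)"
    using sum.reindex_bij_betw[OF e, of "\<lambda>b. ((x - c) \<bullet> b)\<^sup>2"] by (simp add: inner_diff_left)
  also have "\<dots> = (norm (x - c))\<^sup>2"
    unfolding power2_norm_eq_inner by (subst euclidean_inner) (simp add: power2_eq_square)
  finally have "exp (\<Sum>i\<in>I. - (x \<bullet> e i - c \<bullet> e i)\<^sup>2 / (2 * s\<^sup>2)) = exp (- (norm (x - c))\<^sup>2 / (2 * s\<^sup>2))"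
    by (simp add: sum_divide_distrib[symmetric] sum_negf)
  moreover have "card I = DIM('a)" using e by (rule bij_betw_same_card)
  ultimately show ?thesis
    unfolding normal_density_def prod.distrib using assms(1) by (simp add: exp_sum)
qed

lemma gaussian_eq_distr_PiM:
  fixes e :: "'i \<Rightarrow> 'a::euclidean_space"
  assumes fin: "finite I" and e: "bij_betw e I Basis" and s: "0 < s"
  shows "gaussian c s = distr (PiM I (\<lambda>i. density lborel (\<lambda>x. ennreal (normal_density (c \<bullet> e i) s x)))) borel
    (\<lambda>g. \<Sum>i\<in>I. g i *\<^sub>R e i)"
proof -
  define D where "D = (\<lambda>x. ennreal ((1 / sqrt (2 * pi * s\<^sup>2)) ^ DIM('a) * exp (- (norm (x - c))\<^sup>2 / (2 * s\<^sup>2))))"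
  let ?T = "\<lambda>g. \<Sum>i\<in>I. g i *\<^sub>R e i"
  have T[measurable]: "?T \<in> measurable (PiM I (\<lambda>_. lborel :: real measure)) borel" by measurable
  have ei: "e i \<in> Basis" if "i \<in> I" for i using e that by (auto simp: bij_betw_def)
  have inner_e: "?T g \<bullet> e j = g j" if "j \<in> I" for g j
  proof -
    have "?T g \<bullet> e j = (\<Sum>i\<in>I. if i = j then g i else 0)"
      unfolding inner_sum_left using e that
      by (intro sum.cong refl) (auto simp: inner_Basis ei bij_betw_def inj_on_eq_iff)
    then show ?thesis using that fin by simp
  qed
  have [measurable]: "D \<in> borel_measurable borel" unfolding D_def by measurable
  have "gaussian c s = density (distr (PiM I (\<lambda>_. lborel)) borel ?T) D"
    unfolding gaussian_def D_def[symmetric] using lborel_eq_distr_PiM_basis[OF fin e] by simp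
  also have "\<dots> = distr (density (PiM I (\<lambda>_. lborel)) (\<lambda>g. D (?T g))) borel ?T"
    by (intro density_distr) auto
  also have "(\<lambda>g. D (?T g)) = (\<lambda>g. \<Prod>i\<in>I. ennreal (normal_density (c \<bullet> e i) s (g i)))"
    unfolding D_def prod_normal_density[OF fin e, symmetric] by (simp add: inner_e prod_ennreal)
  also have "density (PiM I (\<lambda>_. lborel)) \<dots> = PiM I (\<lambda>i. density lborel (\<lambda>x. ennreal (normal_density (c \<bullet> e i) s x)))"
    using s by (intro PiM_density[symmetric] fin)
      (auto intro!: prob_space_imp_sigma_finite prob_space_normal_density sigma_finite_lborel)
  finally show ?thesis .
qed

lemma prob_space_gaussian:
  fixes c :: "'a::euclidean_space"
  assumes s: "0 < s"
  shows "prob_space (gaussian c s)"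
  unfolding gaussian_eq_distr_PiM[OF finite_Basis bij_betw_id s, of c]
  using s by (intro prob_space.prob_space_distr prob_space_PiM prob_space_normal_density) auto

lemma distr_gaussian_orthogonal:
  fixes f :: "'a::euclidean_space \<Rightarrow> 'a"
  assumes f: "orthogonal_transformation f"
  shows "distr (gaussian c s) borel f = gaussian (f c) s"
proof -
  have lf: "linear f" using f by (rule orthogonal_transformation_linear)
  then have fm[measurable]: "f \<in> borel_measurable borel"
    by (intro borel_measurable_continuous_onI linear_continuous_on linear_conv_bounded_linear[THEN iffD1])
  have "norm (f x - f c) = norm (x - c)" for x
    by (simp add: linear_diff[OF lf, symmetric] orthogonal_transformation_norm[OF f])
  then have "distr (gaussian c s) borel f = density (distr lborel borel f)
      (\<lambda>x. ennreal ((1 / sqrt (2 * pi * s\<^sup>2)) ^ DIM('a) * exp (- (norm (x - f c))\<^sup>2 / (2 * s\<^sup>2))))"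
    unfolding gaussian_def by (subst density_distr) simp_all
  then show ?thesis unfolding gaussian_def lborel_distr_orthogonal[OF f] .
qed

lemma distr_gaussian_translate:
  fixes c :: "'a::euclidean_space"
  shows "distr (gaussian c s) borel (\<lambda>x. d + x) = gaussian (d + c) s"
proof -
  have "distr (gaussian c s) borel (\<lambda>x. d + x) = density (distr lborel borel ((+) d))
      (\<lambda>x. ennreal ((1 / sqrt (2 * pi * s\<^sup>2)) ^ DIM('a) * exp (- (norm (x - (d + c)))\<^sup>2 / (2 * s\<^sup>2))))"
    unfolding gaussian_def by (subst density_distr) (simp_all add: add_diff_add)
  then show ?thesis unfolding gaussian_def lborel_distr_plus .
qed

lemma distr_gaussian_scale:
  fixes c :: "'a::euclidean_space"
  assumes "0 < s"
  shows "distr (gaussian c 1) borel (\<lambda>x. s *\<^sub>R x) = gaussian (s *\<^sub>R c) s"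
proof -
  let ?D = "\<lambda>x::'a. ennreal ((1 / sqrt (2 * pi * s\<^sup>2)) ^ DIM('a) * exp (- (norm (x - s *\<^sub>R c))\<^sup>2 / (2 * s\<^sup>2)))"
  have "lborel = density (distr lborel borel (\<lambda>x::'a. s *\<^sub>R x)) (\<lambda>_. s ^ DIM('a))"
    using lborel_affine[of s 0] assms by simp
  then have "gaussian (s *\<^sub>R c) s = density (density (distr lborel borel (\<lambda>x::'a. s *\<^sub>R x)) (\<lambda>_. s ^ DIM('a))) ?D"
    unfolding gaussian_def by simp
  also have "\<dots> = density (distr lborel borel (\<lambda>x::'a. s *\<^sub>R x)) (\<lambda>x. ennreal (s ^ DIM('a)) * ?D x)"
    by (intro density_density_eq) auto
  also have "\<dots> = distr (density lborel (\<lambda>x. ennreal (s ^ DIM('a)) * ?D (s *\<^sub>R x))) borel (\<lambda>x. s *\<^sub>R x)"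
    by (intro density_distr) auto
  also have "(\<lambda>x. ennreal (s ^ DIM('a)) * ?D (s *\<^sub>R x))
      = (\<lambda>x. ennreal ((1 / sqrt (2 * pi * 1\<^sup>2)) ^ DIM('a) * exp (- (norm (x - c))\<^sup>2 / (2 * 1\<^sup>2))))"
  proof
    fix x
    have "norm (s *\<^sub>R x - s *\<^sub>R c) = s * norm (x - c)" using assms by (simp add: scaleR_diff_right[symmetric])
    then show "ennreal (s ^ DIM('a)) * ?D (s *\<^sub>R x)
      = ennreal ((1 / sqrt (2 * pi * 1\<^sup>2)) ^ DIM('a) * exp (- (norm (x - c))\<^sup>2 / (2 * 1\<^sup>2)))"
      using assms by (simp add: ennreal_mult'[symmetric] real_sqrt_mult power_mult_distrib power_divide)
  qed
  finally show ?thesis unfolding gaussian_def by simp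
qed

lemma bij_betw_axis_axis: "bij_betw (\<lambda>(i, j). axis i (axis j 1)) (UNIV :: ('m::finite \<times> 'n::finite) set) (Basis :: (real ^ 'n ^ 'm) set)"
  by (auto simp: bij_betw_def inj_on_def axis_eq_axis Basis_vec_def image_iff)

lemma bij_betw_axis: "bij_betw (\<lambda>i. axis i 1) (UNIV :: 'n::finite set) (Basis :: (real ^ 'n) set)"
  by (auto simp: bij_betw_def inj_on_def axis_eq_axis Basis_vec_def image_iff)

lemma sum_axis_axis: "(\<Sum>p\<in>UNIV. g p *\<^sub>R (case p of (i, j) \<Rightarrow> axis i (axis j 1))) = (\<chi> i j. (g (i, j) :: real))"
proof -
  have "(\<Sum>p\<in>UNIV. g p *\<^sub>R (case p of (i, j) \<Rightarrow> axis i (axis j 1))) $ k $ l = g (k, l)" for k l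
  proof -
    have "(\<Sum>p\<in>UNIV. g p *\<^sub>R (case p of (i, j) \<Rightarrow> axis i (axis j 1))) $ k $ l
        = (\<Sum>p\<in>UNIV. if p = (k, l) then g p else 0)"
      unfolding sum_component by (intro sum.cong refl) (auto simp: axis_def split: prod.splits)
    then show ?thesis by simp
  qed
  then show ?thesis by (simp add: vec_eq_iff)
qed

lemma gaussian_matrix_eq_gaussian:
  fixes A :: "real ^ 'n ^ 'm"
  assumes "0 < s"
  shows "gaussian_matrix A s = gaussian A s"
proof -
  let ?N = "PiM UNIV (\<lambda>_::'m \<times> 'n. density lborel (\<lambda>x. ennreal (normal_density 0 s x)))"
  have m[measurable]: "(\<lambda>g. \<chi> i j. g (i, j)) \<in> borel_measurable ?N"
    unfolding sum_axis_axis[symmetric] by measurable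
  have "gaussian_matrix A s = distr (distr ?N borel (\<lambda>g. \<chi> i j. g (i, j))) borel (\<lambda>x. A + x)"
    unfolding gaussian_matrix_def by (simp add: distr_distr comp_def)
  also have "distr ?N borel (\<lambda>g. \<chi> i j. g (i, j)) = gaussian 0 s"
    using gaussian_eq_distr_PiM[OF finite bij_betw_axis_axis assms, of "0 :: real ^ 'n ^ 'm"]
    by (simp add: sum_axis_axis)
  finally show ?thesis by (simp add: distr_gaussian_translate)
qed

section \<open>Small-ball estimates\<close>

text \<open>Each coordinate density is replaced by its maximum, so the bound does not depend on the
  centres. This uniformity is what later permits rotations, which move the centre.\<close>

lemma emeasure_PiM_normal_ball_le:
  assumes fin: "finite K" and s: "0 < s" and r: "0 < r"
  shows "emeasure (PiM K (\<lambda>i. density lborel (\<lambda>x. ennreal (normal_density (c i) s x))))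
      {g \<in> space (PiM K (\<lambda>_. lborel :: real measure)). sqrt (\<Sum>i\<in>K. (g i)\<^sup>2) \<le> r}
    \<le> ennreal (unit_ball_vol (real (card K)) * (r / (sqrt (2 * pi) * s)) ^ card K)"
proof -
  let ?U = "{g \<in> space (PiM K (\<lambda>_. lborel :: real measure)). sqrt (\<Sum>i\<in>K. (g i)\<^sup>2) \<le> r}"
  let ?C = "1 / (sqrt (2 * pi) * s)"
  have U[measurable]: "?U \<in> sets (PiM K (\<lambda>_. lborel))" by measurable
  have nd: "normal_density m s x \<le> ?C" for m x
  proof -
    have "normal_density m s x \<le> 1 / sqrt (2 * pi * s\<^sup>2) * 1"
      unfolding normal_density_def using s by (intro mult_left_mono) auto
    then show ?thesis using s by (simp add: real_sqrt_mult)
  qed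
  have "PiM K (\<lambda>i. density lborel (\<lambda>x. ennreal (normal_density (c i) s x)))
      = density (PiM K (\<lambda>_. lborel)) (\<lambda>g. \<Prod>i\<in>K. ennreal (normal_density (c i) s (g i)))"
    using s by (intro PiM_density fin)
      (auto intro!: prob_space_imp_sigma_finite prob_space_normal_density sigma_finite_lborel)
  also have "emeasure \<dots> ?U = (\<integral>\<^sup>+g. (\<Prod>i\<in>K. ennreal (normal_density (c i) s (g i))) * indicator ?U g \<partial>PiM K (\<lambda>_. lborel))"
    by (intro emeasure_density) measurable
  also have "\<dots> \<le> (\<integral>\<^sup>+g. ennreal (?C ^ card K) * indicator ?U g \<partial>PiM K (\<lambda>_. lborel))"
  proof (intro nn_integral_mono mult_right_mono)
    fix g :: "'a \<Rightarrow> real"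
    have "(\<Prod>i\<in>K. normal_density (c i) s (g i)) \<le> (\<Prod>i\<in>K. ?C)"
      by (intro prod_mono) (auto simp: nd)
    then show "(\<Prod>i\<in>K. ennreal (normal_density (c i) s (g i))) \<le> ennreal (?C ^ card K)"
      by (simp add: prod_ennreal ennreal_leI)
  qed auto
  also have "\<dots> = ennreal (?C ^ card K) * emeasure (PiM K (\<lambda>_. lborel)) ?U"
    by (simp add: nn_integral_cmult)
  also have "emeasure (PiM K (\<lambda>_. lborel)) ?U = ennreal (unit_ball_vol (real (card K)) * r ^ card K)"
    unfolding emeasure_cball_aux[OF fin r, symmetric] by (intro arg_cong2[where f = emeasure] refl) auto
  also have "ennreal (?C ^ card K) * \<dots> = ennreal (unit_ball_vol (real (card K)) * (r / (sqrt (2 * pi) * s)) ^ card K)"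
    using s r by (simp add: ennreal_mult[symmetric] power_divide)
  finally show ?thesis .
qed

text \<open>The map takes the standard basis vector \<open>h b\<close> to b. It turns an orthonormal
  system adapted to a subspace into coordinate axes, along which the Gaussian is a product.\<close>

lemma orthonormal_map:
  fixes C :: "'a::euclidean_space set"
  assumes C: "pairwise orthogonal C" "\<And>b. b \<in> C \<Longrightarrow> norm b = 1" and h: "bij_betw h C Basis"
  defines "g \<equiv> \<lambda>y. \<Sum>b\<in>C. (y \<bullet> h b) *\<^sub>R b"
  shows "orthogonal_transformation g" "\<And>b y. b \<in> C \<Longrightarrow> g y \<bullet> b = y \<bullet> h b"
proof -
  have fin: "finite C" using h finite_Basis bij_betw_finite by blast
  show gb: "g y \<bullet> b = y \<bullet> h b" if "b \<in> C" for b y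
  proof -
    have "b \<bullet> b = 1" using C(2)[OF that] by (simp add: norm_eq_sqrt_inner)
    then have "g y \<bullet> b = (\<Sum>b'\<in>C. if b' = b then y \<bullet> h b' else 0)"
      unfolding g_def inner_sum_left using C(1) that
      by (intro sum.cong refl) (auto simp: pairwise_def orthogonal_def)
    then show ?thesis using that fin by simp
  qed
  have lin: "linear g"
    unfolding g_def by (intro linear_compose_sum ballI linearI) (auto simp: inner_add_left scaleR_add_left)
  have "norm (g y) = norm y" for y
  proof -
    have "(norm (g y))\<^sup>2 = (\<Sum>b\<in>C. (y \<bullet> h b) * (g y \<bullet> b))"
      unfolding power2_norm_eq_inner by (subst (2) g_def) (simp add: inner_sum_right)
    also have "\<dots> = (\<Sum>b\<in>C. (y \<bullet> h b) * (y \<bullet> h b))" by (intro sum.cong refl) (simp add: gb)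
    also have "\<dots> = (\<Sum>b\<in>Basis. (y \<bullet> b) * (y \<bullet> b))"
      by (rule sum.reindex_bij_betw[OF h])
    also have "\<dots> = (norm y)\<^sup>2" unfolding power2_norm_eq_inner by (subst (2) euclidean_inner) simp
    finally show ?thesis by simp
  qed
  with lin show "orthogonal_transformation g" by (simp add: orthogonal_transformation)
qed

text \<open>The distance to S dominates the length of the projection onto any k orthonormal vectors
  orthogonal to S, and that projection is a k-dimensional Gaussian. Returning a Borel set U that
  covers the neighbourhood spares a measurability argument for the neighbourhood. The dimension
  condition is an inequality because S will be a span of possibly dependent rows.\<close>

lemma gaussian_near_subspace:
  fixes c :: "'a::euclidean_space" and S :: "'a set"
  assumes S: "subspace S" "dim S + k \<le> DIM('a)" and s: "0 < s" and r: "0 < r"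
  obtains U where "U \<in> sets borel" "\<And>x y. y \<in> S \<Longrightarrow> norm (x - y) \<le> r \<Longrightarrow> x \<in> U"
    "emeasure (gaussian c s) U \<le> ennreal (unit_ball_vol (real k) * (r / (sqrt (2 * pi) * s)) ^ k)"
proof -
  define T where "T = {y \<in> UNIV. \<forall>x\<in>S. orthogonal x y}"
  have "subspace T" unfolding T_def by (auto simp: subspace_def orthogonal_clauses orthogonal_def inner_add_right)
  have "dim T + dim S = DIM('a)"
    unfolding T_def using dim_subspace_orthogonal_to_vectors[OF S(1) subspace_UNIV] by simp
  then have dT: "dim T \<ge> k" using S(2) by simp
  obtain B2 where B2: "B2 \<subseteq> T" "pairwise orthogonal B2" "\<And>x. x \<in> B2 \<Longrightarrow> norm x = 1" "independent B2" "card B2 = dim T"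
    using orthonormal_basis_subspace[OF \<open>subspace T\<close>] by metis
  \<comment> \<open>Exactly k directions are kept even if the complement is larger, so that the
    exponent does not depend on dim S.\<close>
  obtain B where B: "B \<subseteq> B2" "card B = k" "finite B" using obtain_subset_with_card_n[of k B2] dT B2(5) by metis
  define W where "W = {y \<in> UNIV. \<forall>x\<in>span B. orthogonal x y}"
  have "subspace W" unfolding W_def by (auto simp: subspace_def orthogonal_clauses orthogonal_def inner_add_right)
  have "independent B" using B2(4) B(1) independent_mono by blast
  then have "dim (span B) = k" using B(2) by (simp add: dim_eq_card_independent)
  then have dW: "dim W + k = DIM('a)"
    unfolding W_def using dim_subspace_orthogonal_to_vectors[OF subspace_span[of B] subspace_UNIV] by simp
  \<comment> \<open>B is completed to an orthonormal basis of the whole space, so that a rotation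
    onto the coordinate axes exists.\<close>
  obtain B1 where B1: "B1 \<subseteq> W" "pairwise orthogonal B1" "\<And>x. x \<in> B1 \<Longrightarrow> norm x = 1" "independent B1" "card B1 = dim W"
    using orthonormal_basis_subspace[OF \<open>subspace W\<close>] by metis
  have fB1: "finite B1" using B1(4) by (rule independent_imp_finite)
  have BW: "orthogonal b w" if "b \<in> B" "w \<in> B1" for b w
    using that B1(1) span_base[of b B] by (auto simp: W_def)
  then have WB: "orthogonal w b" if "b \<in> B" "w \<in> B1" for b w
    using that by (simp add: orthogonal_commute)
  define C where "C = B \<union> B1"
  have disj: "B \<inter> B1 = {}"
  proof (rule ccontr)
    assume "B \<inter> B1 \<noteq> {}"
    then obtain b where b: "b \<in> B" "b \<in> B1" by auto
    then have "orthogonal b b" "norm b = 1" using BW B1(3) by auto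
    then show False by (simp add: orthogonal_self)
  qed
  have C: "pairwise orthogonal C" "\<And>b. b \<in> C \<Longrightarrow> norm b = 1"
    unfolding C_def using B2(2,3) B(1) B1(2,3) BW WB
    by (auto simp: pairwise_def)
  have cC: "finite C" "card C = DIM('a)"
    unfolding C_def using B fB1 disj dW B1(5) by (simp_all add: card_Un_disjoint)
  obtain h where h: "bij_betw h C (Basis :: 'a set)"
    using finite_same_card_bij[OF cC(1) finite_Basis cC(2)] by blast
  define g where "g = (\<lambda>y. \<Sum>b\<in>C. (y \<bullet> h b) *\<^sub>R b)"
  have g: "orthogonal_transformation g" and gb: "\<And>b y. b \<in> C \<Longrightarrow> g y \<bullet> b = y \<bullet> h b"
    unfolding g_def using orthonormal_map[OF C h] by auto
  define K where "K = h ` B"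
  have hB: "inj_on h B" using h unfolding C_def bij_betw_def by (auto simp: inj_on_Un)
  have KB: "K \<subseteq> Basis" using h unfolding K_def C_def bij_betw_def by auto
  have cK: "card K = k" "finite K" unfolding K_def using hB B by (simp_all add: card_image)
  have sumK: "(\<Sum>b\<in>K. (y \<bullet> b)\<^sup>2) = (\<Sum>b\<in>B. (g y \<bullet> b)\<^sup>2)" for y
    unfolding K_def using gb hB by (simp add: sum.reindex C_def)
  have lg: "linear g" using g by (rule orthogonal_transformation_linear)
  have gm[measurable]: "g \<in> borel_measurable borel"
    using lg by (intro borel_measurable_continuous_onI linear_continuous_on linear_conv_bounded_linear[THEN iffD1])
  obtain c' where c': "c = g c'" using orthogonal_transformation_surj[OF g] by (metis surjE)
  define U where "U = {x. sqrt (\<Sum>b\<in>B. (x \<bullet> b)\<^sup>2) \<le> r}"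
  have Um: "U \<in> sets borel"
    unfolding U_def by (intro borel_closed closed_Collect_le continuous_intros)
  have "emeasure (gaussian c s) U = emeasure (gaussian c' s) (g -` U)"
    unfolding c' distr_gaussian_orthogonal[OF g, symmetric] using Um by (subst emeasure_distr) auto
  also have "g -` U = {x. sqrt (\<Sum>b\<in>K. (x \<bullet> b)\<^sup>2) \<le> r}" unfolding U_def sumK by auto
  also have "emeasure (gaussian c' s) \<dots> = emeasure (PiM Basis (\<lambda>b. density lborel (\<lambda>x. ennreal (normal_density (c' \<bullet> b) s x))))
      {x \<in> space (PiM Basis (\<lambda>b. density lborel (\<lambda>x. ennreal (normal_density (c' \<bullet> b) s x)))). sqrt (\<Sum>b\<in>K. (x b)\<^sup>2) \<le> r}"
  proof -
    have in_sum: "(\<Sum>i\<in>Basis. x i *\<^sub>R id i) \<bullet> b = x b" if "b \<in> Basis" for b :: 'a and x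
      using that by (simp add: inner_sum_left_Basis)
    have meas: "{x. sqrt (\<Sum>b\<in>K. (x \<bullet> b)\<^sup>2) \<le> r} \<in> sets borel"
      by (intro borel_closed closed_Collect_le continuous_intros)
    show ?thesis
      unfolding gaussian_eq_distr_PiM[OF finite_Basis bij_betw_id s, of c']
      using meas KB by (subst emeasure_distr) (auto intro!: arg_cong2[where f = emeasure] sum.cong simp: in_sum subset_iff)
  qed
  also have "\<dots> \<le> ennreal (unit_ball_vol (real k) * (r / (sqrt (2 * pi) * s)) ^ k)"
  proof -
    let ?N = "\<lambda>b. density lborel (\<lambda>x. ennreal (normal_density (c' \<bullet> b) s x))"
    interpret product_prob_space ?N Basis by (intro product_prob_spaceI prob_space_normal_density s)
    let ?V = "{g \<in> space (PiM K (\<lambda>_. lborel :: real measure)). sqrt (\<Sum>i\<in>K. (g i)\<^sup>2) \<le> r}"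
    have sK: "sets (PiM K ?N) = sets (PiM K (\<lambda>_. lborel))" by (intro sets_PiM_cong) auto
    have "?V \<in> sets (PiM K (\<lambda>_. lborel))" by measurable
    then have V: "?V \<in> sets (PiM K ?N)" unfolding sK .
    have "emeasure (PiM K ?N) ?V = emeasure (distr (PiM Basis ?N) (PiM K ?N) (\<lambda>x. restrict x K)) ?V"
      using distr_PiM_restrict_finite[OF cK(2) KB] by simp
    also have "\<dots> = emeasure (PiM Basis ?N) ((\<lambda>x. restrict x K) -` ?V \<inter> space (PiM Basis ?N))"
      using V KB by (intro emeasure_distr measurable_restrict_subset)
    also have "(\<lambda>x. restrict x K) -` ?V \<inter> space (PiM Basis ?N) = {x \<in> space (PiM Basis ?N). sqrt (\<Sum>b\<in>K. (x b)\<^sup>2) \<le> r}"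
      by (auto simp: space_PiM)
    finally show ?thesis using emeasure_PiM_normal_ball_le[OF cK(2) s r, of "\<lambda>b. c' \<bullet> b"] cK(1) by simp
  qed
  finally have Ub: "emeasure (gaussian c s) U \<le> ennreal (unit_ball_vol (real k) * (r / (sqrt (2 * pi) * s)) ^ k)" .
  have "x \<in> U" if y: "y \<in> S" and n: "norm (x - y) \<le> r" for x y
  proof -
    obtain w where w: "x - y = g w" using orthogonal_transformation_surj[OF g] by (metis surjE)
    have "(\<Sum>b\<in>B. (x \<bullet> b)\<^sup>2) = (\<Sum>b\<in>B. (g w \<bullet> b)\<^sup>2)"
    proof (intro sum.cong refl)
      fix b assume "b \<in> B"
      then have "orthogonal y b" using B(1) B2(1) y by (auto simp: T_def)
      then show "(x \<bullet> b)\<^sup>2 = (g w \<bullet> b)\<^sup>2" unfolding w[symmetric] by (simp add: inner_diff_left orthogonal_def)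
    qed
    also have "\<dots> = (\<Sum>b\<in>K. (w \<bullet> b)\<^sup>2)" by (simp add: sumK)
    also have "\<dots> \<le> (\<Sum>b\<in>Basis. (w \<bullet> b)\<^sup>2)" using KB by (intro sum_mono2) auto
    also have "\<dots> = (norm w)\<^sup>2" unfolding power2_norm_eq_inner by (subst euclidean_inner) (simp add: power2_eq_square)
    also have "norm w = norm (x - y)" unfolding w using g by (simp add: orthogonal_transformation_norm)
    finally have "sqrt (\<Sum>b\<in>B. (x \<bullet> b)\<^sup>2) \<le> norm (x - y)" by (simp add: real_le_lsqrt)
    then show ?thesis unfolding U_def using n by simp
  qed
  then show thesis using that Um Ub by blast
qed

section \<open>One row of a Gaussian matrix and the span of the others\<close>

lemma bij_betw_row_axis:
  "bij_betw (\<lambda>p. axis (snd p) 1) ({i} \<times> UNIV :: ('m \<times> 'n::finite) set) (Basis :: (real ^ 'n) set)"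
  by (auto simp: bij_betw_def inj_on_def axis_eq_axis Basis_vec_def image_iff)

text \<open>Rows are independent: with the other rows fixed, their span has dimension at most m - 1,
  so row i, itself Gaussian, has to lie near a subspace of codimension at least k. Stating the bound
  for a Borel set E contained in this event keeps the iterated integrals measurable.\<close>

lemma gaussian_row_near_span:
  fixes c :: "real ^ 'n ^ 'm" and E :: "(real ^ 'n ^ 'm) set"
  assumes k: "CARD('m) + k = CARD('n) + 1" and s: "0 < s" and r: "0 < r"
    and E: "E \<in> sets borel" and near: "\<And>A. A \<in> E \<Longrightarrow> \<exists>v\<in>span {A $ j |j. j \<noteq> i}. norm (A $ i - v) \<le> r"
  shows "emeasure (gaussian c s) E \<le> ennreal (unit_ball_vol (real k) * (r / (sqrt (2 * pi) * s)) ^ k)"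
    (is "_ \<le> ?K")
proof -
  let ?N = "\<lambda>p. density lborel (\<lambda>x. ennreal (normal_density (c $ fst p $ snd p) s x))"
  let ?T = "\<lambda>g. (\<chi> i j. g (i, j)) :: real ^ 'n ^ 'm"
  define R I where "R = {p::'m \<times> 'n. fst p \<noteq> i}" and "I = {i} \<times> (UNIV :: 'n set)"
  interpret product_prob_space ?N UNIV by (intro product_prob_spaceI prob_space_normal_density s)
  have RI: "R \<inter> I = {}" "R \<union> I = UNIV" "finite R" "finite I" unfolding R_def I_def by auto
  interpret PR: prob_space "PiM R ?N" by (intro prob_space_PiM prob_space_normal_density s)
  have ce: "c \<bullet> (case p of (i, j) \<Rightarrow> axis i (axis j 1)) = c $ fst p $ snd p" for p
    by (cases p) (simp add: inner_axis)
  have T[measurable]: "?T \<in> borel_measurable (PiM UNIV ?N)"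
    unfolding sum_axis_axis[symmetric] by measurable
  have "gaussian c s = distr (PiM UNIV ?N) borel ?T"
    using gaussian_eq_distr_PiM[OF finite bij_betw_axis_axis s, of c] unfolding sum_axis_axis ce .
  then have "emeasure (gaussian c s) E = (\<integral>\<^sup>+g. indicator E (?T g) \<partial>PiM UNIV ?N)"
    using E T by (simp add: nn_integral_distr flip: nn_integral_indicator)
  also have "\<dots> = (\<integral>\<^sup>+x. (\<integral>\<^sup>+y. indicator E (?T (merge R I (x, y))) \<partial>PiM I ?N) \<partial>PiM R ?N)"
    using product_nn_integral_fold[OF RI(1,3,4), of "\<lambda>g. indicator E (?T g)"] E T unfolding RI(2) by simp
  also have "\<dots> \<le> (\<integral>\<^sup>+x. ?K \<partial>PiM R ?N)"
  proof (intro nn_integral_mono)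
    fix x
    define S where "S = span ((\<lambda>j. \<chi> l. x (j, l)) ` (- {i}) :: (real ^ 'n) set)"
    have "dim S \<le> card ((\<lambda>j. \<chi> l. x (j, l)) ` (- {i}) :: (real ^ 'n) set)"
      unfolding S_def by (intro dim_le_card) auto
    also have "\<dots> \<le> card (- {i} :: 'm set)" by (rule card_image_le) simp
    also have "card (- {i} :: 'm set) = CARD('m) - 1" by (simp add: Compl_eq_Diff_UNIV)
    finally have "dim S + k \<le> DIM(real ^ 'n)" 
      using k zero_less_card_finite[where 'a = 'm] unfolding DIM_cart DIM_real by linarith
    then obtain U where U: "U \<in> sets borel" "\<And>x y. y \<in> S \<Longrightarrow> norm (x - y) \<le> r \<Longrightarrow> x \<in> U"
      "emeasure (gaussian (c $ i) s) U \<le> ?K"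
      using gaussian_near_subspace[of S k s r "c $ i"] s r unfolding S_def by blast
    let ?row = "\<lambda>y. \<Sum>p\<in>I. y p *\<^sub>R axis (snd p) 1 :: real ^ 'n"
    have row: "?row y = (\<chi> j. y (i, j))" for y
    proof -
      have "?row y = (\<Sum>j\<in>UNIV. y (i, j) *\<^sub>R axis j 1)"
        unfolding I_def by (subst sum.reindex_bij_betw[of "\<lambda>j. (i, j)" UNIV, symmetric]) (auto simp: bij_betw_def inj_on_def)
      then show ?thesis by (simp add: vec_eq_iff axis_def if_distrib cong: if_cong)
    qed
    have "(\<integral>\<^sup>+y. indicator E (?T (merge R I (x, y))) \<partial>PiM I ?N) \<le> (\<integral>\<^sup>+y. indicator U (?row y) \<partial>PiM I ?N)"
    proof (intro nn_integral_mono)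
      fix y
      let ?A = "?T (merge R I (x, y))"
      have "?A $ j = (\<chi> l. x (j, l))" if "j \<noteq> i" for j using that by (simp add: vec_eq_iff merge_def R_def)
      then have "(\<lambda>j. ?A $ j) ` (- {i}) = (\<lambda>j. \<chi> l. x (j, l)) ` (- {i})" by (intro image_cong) auto
      then have sp: "{?A $ j |j. j \<noteq> i} = (\<lambda>j. \<chi> l. x (j, l)) ` (- {i})" by (simp only: image_def) blast
      have Ai: "?A $ i = ?row y" unfolding row by (simp add: vec_eq_iff merge_def R_def I_def)
      have "?row y \<in> U" if "?A \<in> E" using near[OF that] U(2) unfolding sp Ai S_def by blast
      then show "indicator E ?A \<le> (indicator U (?row y) :: ennreal)" by (simp add: indicator_def)
    qed
    also have "\<dots> = emeasure (distr (PiM I ?N) borel ?row) U"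
      using U(1) by (simp add: nn_integral_distr flip: nn_integral_indicator)
    also have "distr (PiM I ?N) borel ?row = gaussian (c $ i) s"
    proof -
      have "PiM I ?N = PiM I (\<lambda>p. density lborel (\<lambda>x. ennreal (normal_density (c $ i \<bullet> axis (snd p) 1) s x)))"
        by (intro PiM_cong) (auto simp: I_def inner_axis)
      then show ?thesis
        using gaussian_eq_distr_PiM[OF RI(4) bij_betw_row_axis[of i, where 'n = 'n, folded I_def] s, of "c $ i"] by simp
    qed
    finally show "(\<integral>\<^sup>+y. indicator E (?T (merge R I (x, y))) \<partial>PiM I ?N) \<le> ?K" using U(3) by simp
  qed
  also have "\<dots> = ?K" by (simp add: PR.emeasure_space_1)
  finally show ?thesis .
qed

section \<open>Matrices with a small singular value\<close>

lemma orthogonal_transformation_matrix_mult: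
  fixes W :: "real ^ 'm ^ 'm"
  assumes W: "orthogonal_matrix W"
  shows "orthogonal_transformation (\<lambda>A :: real ^ 'n ^ 'm. W ** A)"
proof -
  \<comment> \<open>W acts on each column separately, and the Frobenius inner product is the sum of
    the inner products of the columns.\<close>
  have col: "column j (W ** A) = W *v column j A" for j and A :: "real ^ 'n ^ 'm"
    by (simp add: vec_eq_iff column_def matrix_matrix_mult_def matrix_vector_mult_def)
  have inn: "A \<bullet> B = (\<Sum>j\<in>UNIV. column j A \<bullet> column j B)" for A B :: "real ^ 'n ^ 'm"
    unfolding inner_vec_def column_def by (subst sum.swap) simp
  have "orthogonal_transformation ((*v) W)" using W by (simp add: orthogonal_transformation_matrix)
  then have "(W ** A) \<bullet> (W ** B) = A \<bullet> B" for A B :: "real ^ 'n ^ 'm"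
    unfolding inn col by (simp add: orthogonal_transformation_def)
  moreover have "linear (\<lambda>A :: real ^ 'n ^ 'm. W ** A)"
    by (rule linearI) (simp_all add: distrib_left sum.distrib vec_eq_iff matrix_matrix_mult_def sum_distrib_left mult_ac)
  ultimately show ?thesis by (simp add: orthogonal_transformation_def)
qed

text \<open>The witness \<open>y\<close> of a small singular value is restricted to lie at an angle of cosine at
  least \<open>\<rho>\<close> to \<open>u\<close>; averaging over \<open>u\<close> will remove this restriction.\<close>

definition tilted :: "real \<Rightarrow> real \<Rightarrow> ((real ^ 'n ^ 'm) \<times> (real ^ 'm)) set" where
  "tilted \<tau> \<rho> = {(A, u). \<exists>y. norm y = 1 \<and> \<rho> * norm u \<le> \<bar>y \<bullet> u\<bar> \<and> norm (y v* A) \<le> \<tau>}"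

text \<open>The smallest of the m singular values is at most \<tau>: \<open>y v* A\<close> is the
  transpose of A applied to y. For \<tau> >= 0 all matrices of row rank below m belong to the
  set.\<close>

definition small_singular :: "real \<Rightarrow> (real ^ 'n ^ 'm) set" where
  "small_singular \<tau> = {A. \<exists>y. norm y = 1 \<and> norm (y v* A) \<le> \<tau>}"

lemma continuous_on_vector_matrix_mult:
  fixes f :: "'a::topological_space \<Rightarrow> real ^ 'm" and g :: "'a \<Rightarrow> real ^ 'n ^ 'm"
  assumes "continuous_on S f" "continuous_on S g"
  shows "continuous_on S (\<lambda>x. f x v* g x)"
  unfolding vector_matrix_mult_def using assms by (intro continuous_intros continuous_on_vec_lambda) auto

text \<open>Projecting a closed set along the compact sphere leaves it closed. The existential
  quantifier over y thus yields a set that is Borel jointly in A and u, as Fubini will need.\<close>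

lemma closed_tilted: "closed (tilted \<tau> \<rho> :: ((real ^ 'n ^ 'm) \<times> (real ^ 'm)) set)"
proof -
  let ?T = "{q :: (real ^ 'm) \<times> (real ^ 'n ^ 'm) \<times> (real ^ 'm). \<rho> * norm (snd (snd q)) \<le> \<bar>fst q \<bullet> snd (snd q)\<bar>
      \<and> norm (fst q v* fst (snd q)) \<le> \<tau>}"
  have "closed ?T"
    by (intro closed_Collect_conj closed_Collect_le continuous_intros continuous_on_vector_matrix_mult)
  then have "closed {x. \<exists>y. y \<in> sphere 0 1 \<and> (y, x) \<in> ?T}"
    by (rule closed_compact_projection[OF compact_sphere])
  also have "{x. \<exists>y. y \<in> sphere 0 1 \<and> (y, x) \<in> ?T} = tilted \<tau> \<rho>"
    unfolding tilted_def by auto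
  finally show ?thesis .
qed

lemma closed_small_singular: "closed (small_singular \<tau> :: (real ^ 'n ^ 'm) set)"
proof -
  let ?T = "{q :: (real ^ 'm) \<times> (real ^ 'n ^ 'm). norm (fst q v* snd q) \<le> \<tau>}"
  have "closed ?T"
    by (intro closed_Collect_le continuous_intros continuous_on_vector_matrix_mult)
  then have "closed {x. \<exists>y. y \<in> sphere 0 1 \<and> (y, x) \<in> ?T}"
    by (rule closed_compact_projection[OF compact_sphere])
  also have "{x. \<exists>y. y \<in> sphere 0 1 \<and> (y, x) \<in> ?T} = small_singular \<tau>"
    unfolding small_singular_def by auto
  finally show ?thesis .
qed

lemma emeasure_gaussian_tilted:
  fixes c :: "real ^ 'n ^ 'm" and u :: "real ^ 'm"
  assumes k: "CARD('m) + k = CARD('n) + 1" and s: "0 < s" and \<tau>: "0 < \<tau>" and \<rho>: "0 < \<rho>" and u: "u \<noteq> 0"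
  shows "emeasure (gaussian c s) {A. (A, u) \<in> tilted \<tau> \<rho>}
    \<le> ennreal (unit_ball_vol (real k) * (\<tau> / \<rho> / (sqrt (2 * pi) * s)) ^ k)"
proof -
  obtain i :: 'm where True by simp
  have nu: "norm u = norm (norm u *\<^sub>R axis i 1 :: real ^ 'm)" by simp
  obtain f :: "real ^ 'm \<Rightarrow> real ^ 'm" where f: "orthogonal_transformation f" "f u = norm u *\<^sub>R axis i 1"
    using orthogonal_transformation_exists[OF nu] by auto
  define W where "W = matrix f"
  have W: "orthogonal_matrix W"
    unfolding W_def using orthogonal_transformation_matrix[THEN iffD1, OF f(1)] by (rule conjunct2)
  have fW: "f x = W *v x" for x
    unfolding W_def by (rule fun_cong[OF matrix_vector_mul(2)[OF orthogonal_transformation_linear[OF f(1)], symmetric]])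
  define F where "F = (\<lambda>A :: real ^ 'n ^ 'm. W ** A)"
  have F: "orthogonal_transformation F" unfolding F_def using W by (rule orthogonal_transformation_matrix_mult)
  then have Fm[measurable]: "F \<in> borel_measurable borel"
    by (intro borel_measurable_continuous_onI linear_continuous_on linear_conv_bounded_linear[THEN iffD1]
      orthogonal_transformation_linear)
  have closed_sec: "closed {A :: real ^ 'n ^ 'm. (A, w) \<in> tilted \<tau> \<rho>}" for w
    using closed_vimage[OF closed_tilted[of \<tau> \<rho>], of "\<lambda>A. (A, w)"]
    by (simp add: vimage_def continuous_on_Pair)
  \<comment> \<open>Applying W to the rows of A and to the witness y together leaves
    \<open>y v* A\<close> unchanged, so the singular-value condition survives while u moves to an
    axis.\<close>
  have act: "(W *v y) v* F A = y v* A" for y A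
  proof -
    have "(W *v y) v* F A = y v* (transpose W ** (W ** A))"
      unfolding F_def by (metis vector_matrix_mul_assoc vector_transpose_matrix)
    also have "transpose W ** (W ** A) = A"
      using W by (simp add: matrix_mul_assoc orthogonal_matrix_def)
    finally show ?thesis .
  qed
  let ?E = "{A :: real ^ 'n ^ 'm. (A, f u) \<in> tilted \<tau> \<rho>}"
  have "{A. (A, u) \<in> tilted \<tau> \<rho>} \<subseteq> F -` ?E"
  proof (rule subsetI)
    fix A :: "real ^ 'n ^ 'm" assume "A \<in> {A. (A, u) \<in> tilted \<tau> \<rho>}"
    then obtain y where y: "norm y = 1" "\<rho> * norm u \<le> \<bar>y \<bullet> u\<bar>" "norm (y v* A) \<le> \<tau>"
      unfolding tilted_def by auto
    have "norm (f y) = 1" "norm (f u) = norm u" "f y \<bullet> f u = y \<bullet> u"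
      using f(1) y(1) by (simp_all only: orthogonal_transformation_norm) (simp add: orthogonal_transformation_def)
    then show "A \<in> F -` ?E" using y act[of y A] unfolding tilted_def by (auto simp: fW intro!: exI[of _ "f y"])
  qed
  then have "emeasure (gaussian c s) {A. (A, u) \<in> tilted \<tau> \<rho>} \<le> emeasure (gaussian c s) (F -` ?E)"
    using measurable_sets_borel[OF Fm borel_closed[OF closed_sec]] by (intro emeasure_mono) simp_all
  \<comment> \<open>The rotation moves the centre to \<open>F c\<close>; the row estimate holds for
    every centre.\<close>
  also have "\<dots> = emeasure (gaussian (F c) s) ?E"
    unfolding distr_gaussian_orthogonal[OF F, symmetric] using closed_sec by (subst emeasure_distr) auto
  also have "\<dots> \<le> ennreal (unit_ball_vol (real k) * (\<tau> / \<rho> / (sqrt (2 * pi) * s)) ^ k)"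
  proof (rule gaussian_row_near_span[OF k s])
    show "0 < \<tau> / \<rho>" using \<tau> \<rho> by simp
    show "?E \<in> sets borel" by (rule borel_closed[OF closed_sec])
    fix A assume "A \<in> ?E"
    then obtain y where y: "norm y = 1" "\<rho> * norm u \<le> \<bar>y \<bullet> (norm u *\<^sub>R axis i 1)\<bar>" "norm (y v* A) \<le> \<tau>"
      unfolding tilted_def f(2) by auto
    have yi: "\<rho> \<le> \<bar>y $ i\<bar>" using y(2) u by (simp add: inner_axis abs_mult mult.commute)
    then have yi0: "y $ i \<noteq> 0" using \<rho> by auto
    \<comment> \<open>The small combination \<open>y v* A\<close> is solved for row i: it equals y_i
      (A_i - v), and |y_i| >= \<rho> costs the factor 1 / \<rho>.\<close>
    define v where "v = (\<Sum>j\<in>- {i}. (- (y $ j / y $ i)) *\<^sub>R A $ j)"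
    have "v \<in> span {A $ j |j. j \<noteq> i}"
      unfolding v_def by (intro span_sum span_scale span_base) auto
    moreover have "norm (A $ i - v) \<le> \<tau> / \<rho>"
    proof -
      have "y v* A = (\<Sum>j\<in>UNIV. y $ j *\<^sub>R A $ j)"
        by (simp add: vec_eq_iff vector_matrix_mult_def mult.commute)
      also have "\<dots> = y $ i *\<^sub>R A $ i + (\<Sum>j\<in>- {i}. y $ j *\<^sub>R A $ j)"
        by (subst sum.remove[of _ i]) (auto simp: Compl_eq_Diff_UNIV)
      also have "\<dots> = y $ i *\<^sub>R (A $ i - v)"
        unfolding v_def using yi0 by (simp add: scaleR_diff_right scaleR_add_right scaleR_sum_right sum_negf)
      finally have "\<bar>y $ i\<bar> * norm (A $ i - v) \<le> \<tau>" using y(3) by simp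
      moreover have "\<rho> * norm (A $ i - v) \<le> \<bar>y $ i\<bar> * norm (A $ i - v)" using yi by (intro mult_right_mono) auto
      ultimately show ?thesis using \<rho> by (simp add: field_simps)
    qed
    ultimately show "\<exists>v\<in>span {A $ j |j. j \<noteq> i}. norm (A $ i - v) \<le> \<tau> / \<rho>" by blast
  qed
  finally show ?thesis .
qed

section \<open>Averaging over spherical caps\<close>

text \<open>The integrand is the relative slice radius, to the power d, of the bicone in
  \<open>bicone_subset_cap\<close>. The two pieces contribute \<rho> / (d + 1) and (1 - \<rho>) / (d
  + 1), so the total is that of a single cone of height 1. Such an elementary volume is the reason
  for using a bicone inside the spherical sector.\<close>

lemma has_integral_bicone_profile:
  fixes \<rho> :: real and d :: nat
  assumes \<rho>: "0 < \<rho>" "\<rho> < 1"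
  shows "((\<lambda>x. (min (x / \<rho>) ((1 - x) / (1 - \<rho>))) ^ d) has_integral (1 / real (d + 1))) {0..1}"
proof -
  let ?b = "\<lambda>x. (min (x / \<rho>) ((1 - x) / (1 - \<rho>))) ^ d"
  have le: "x / \<rho> \<le> (1 - x) / (1 - \<rho>) \<longleftrightarrow> x \<le> \<rho>" for x using \<rho> by (simp add: field_simps)
  have der: "((\<lambda>x. c * ((a + e * x) / c) ^ (d + 1) / (e * real (d + 1))) has_vector_derivative ((a + e * x) / c) ^ d) (at x within S)"
    if "c \<noteq> 0" "e \<noteq> 0" for a c e x :: real and S
  proof -
    have "((\<lambda>x. c * ((a + e * x) / c) ^ (d + 1) / (e * real (d + 1))) has_real_derivative
        c * (real (d + 1) * ((a + e * x) / c) ^ d * (e / c)) / (e * real (d + 1))) (at x within S)"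
      using that by (auto intro!: derivative_eq_intros simp del: power_Suc power_divide of_nat_Suc)
    also have "c * (real (d + 1) * ((a + e * x) / c) ^ d * (e / c)) / (e * real (d + 1)) = ((a + e * x) / c) ^ d"
      using that by (simp del: power_divide of_nat_Suc)
    finally show ?thesis by (simp add: has_real_derivative_iff_has_vector_derivative)
  qed
  have "- 1 - real d = - (1 + real d)" by simp
  then have neg: "- ((1 - \<rho>) / (- 1 - real d)) = (1 - \<rho>) / (1 + real d)"
    by (simp only: divide_minus_right minus_minus)
  have "((\<lambda>x. (x / \<rho>) ^ d) has_integral (\<rho> / real (d + 1))) {0..\<rho>}"
    using fundamental_theorem_of_calculus[OF _ der[of \<rho> 1 0], of 0 \<rho>] \<rho> by simp
  then have 1: "(?b has_integral (\<rho> / real (d + 1))) {0..\<rho>}"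
  proof (rule has_integral_eq[rotated])
    fix x assume "x \<in> {0..\<rho>}"
    then show "(x / \<rho>) ^ d = ?b x" using le[of x] \<rho> by (simp add: min_absorb1 del: power_divide)
  qed
  have "((\<lambda>x. ((1 - x) / (1 - \<rho>)) ^ d) has_integral ((1 - \<rho>) / real (d + 1))) {\<rho>..1}"
    using fundamental_theorem_of_calculus[OF _ der[of "1 - \<rho>" "-1" 1], of \<rho> 1] \<rho>
    by (simp add: neg)
  then have 2: "(?b has_integral ((1 - \<rho>) / real (d + 1))) {\<rho>..1}"
  proof (rule has_integral_eq[rotated])
    fix x assume x: "x \<in> {\<rho>..1}"
    show "((1 - x) / (1 - \<rho>)) ^ d = ?b x"
      using le[of x] x \<rho> by (cases "x = \<rho>") (auto simp: min_def)
  qed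
  have "(?b has_integral (\<rho> / real (d + 1) + (1 - \<rho>) / real (d + 1))) {0..1}"
    using \<rho> by (intro has_integral_combine[OF _ _ 1 2]) auto
  then show ?thesis by (simp add: add_divide_distrib[symmetric])
qed

text \<open>The spherical cone over a cap contains the bicone with apexes \<open>0\<close> and the pole of the cap
  and with the rim of the cap as its common base.\<close>

lemma bicone_subset_cap:
  fixes x \<rho> w :: real
  assumes \<rho>: "0 < \<rho>" "\<rho> < 1" and x: "0 < x" "x < 1"
    and w: "0 \<le> w" "w \<le> sqrt (1 - \<rho>\<^sup>2) * min (x / \<rho>) ((1 - x) / (1 - \<rho>))"
  shows "x\<^sup>2 + w\<^sup>2 \<le> 1" "\<rho> * sqrt (x\<^sup>2 + w\<^sup>2) \<le> x"
proof -
  have R: "(sqrt (1 - \<rho>\<^sup>2))\<^sup>2 = 1 - \<rho>\<^sup>2" using \<rho> by (simp add: power_le_one)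
  have R0: "sqrt (1 - \<rho>\<^sup>2) \<ge> 0" using \<rho> by (simp add: power_le_one)
  have "w \<le> sqrt (1 - \<rho>\<^sup>2) * (x / \<rho>)" using w(2) R0 by (meson min.cobounded1 mult_left_mono order_trans)
  then have "w\<^sup>2 \<le> (sqrt (1 - \<rho>\<^sup>2) * (x / \<rho>))\<^sup>2" using w(1) by (intro power_mono) auto
  then have 1: "w\<^sup>2 \<le> (1 - \<rho>\<^sup>2) * (x\<^sup>2 / \<rho>\<^sup>2)" by (simp add: power_mult_distrib R power_divide)
  then have x2: "x\<^sup>2 + w\<^sup>2 \<le> x\<^sup>2 / \<rho>\<^sup>2" using \<rho> by (simp add: field_simps)
  have "w \<le> sqrt (1 - \<rho>\<^sup>2) * ((1 - x) / (1 - \<rho>))" using w(2) R0 by (meson min.cobounded2 mult_left_mono order_trans)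
  then have "w\<^sup>2 \<le> (sqrt (1 - \<rho>\<^sup>2) * ((1 - x) / (1 - \<rho>)))\<^sup>2" using w(1) by (intro power_mono) auto
  then have 2: "w\<^sup>2 \<le> (1 - \<rho>\<^sup>2) * ((1 - x)\<^sup>2 / (1 - \<rho>)\<^sup>2)" by (simp add: power_mult_distrib R power_divide)
  have "\<rho> * sqrt (x\<^sup>2 + w\<^sup>2) \<le> \<rho> * sqrt (x\<^sup>2 / \<rho>\<^sup>2)" using x2 \<rho> by (intro mult_left_mono) auto
  also have "\<dots> = x" using \<rho> x by (simp add: real_sqrt_divide)
  finally show "\<rho> * sqrt (x\<^sup>2 + w\<^sup>2) \<le> x" .
  show "x\<^sup>2 + w\<^sup>2 \<le> 1"
  proof (cases "x \<le> \<rho>")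
    case True
    then have "x\<^sup>2 \<le> \<rho>\<^sup>2" using x by (intro power_mono) auto
    then have "x\<^sup>2 / \<rho>\<^sup>2 \<le> 1" using \<rho> by simp
    with x2 show ?thesis by linarith
  next
    case False
    have "(1 - \<rho>\<^sup>2) * ((1 - x)\<^sup>2 / (1 - \<rho>)\<^sup>2) = (1 + \<rho>) * (1 - x) / (1 - \<rho>) * (1 - x)"
      using \<rho> by (simp add: power2_eq_square divide_simps) (simp add: algebra_simps)
    \<comment> \<open>The quotient (1 - x) / (1 + x) decreases in x, and x > \<rho> in this
      case.\<close>
    also have "\<dots> \<le> (1 + x) * (1 - x)"
    proof (intro mult_right_mono)
      show "(1 + \<rho>) * (1 - x) / (1 - \<rho>) \<le> 1 + x" using \<rho> False by (simp add: field_simps)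
    qed (use x in simp)
    finally show ?thesis using 2 by (simp add: power2_eq_square algebra_simps)
  qed
qed

text \<open>Slicing orthogonally to axis i: at height x in (0, 1) the slice of the sector contains a
  d-dimensional ball of radius sqrt (1 - \<rho>^2) \<open>b x\<close>. The strict condition
  \<open>0 < w $ i\<close> keeps the sector disjoint from its mirror image.\<close>

lemma emeasure_half_cap:
  fixes i :: "'m::finite"
  assumes d: "CARD('m) = d + 1" "1 \<le> d" and \<rho>: "0 < \<rho>" "\<rho> < 1"
  shows "ennreal (unit_ball_vol (real d) * sqrt (1 - \<rho>\<^sup>2) ^ d / real (d + 1))
    \<le> emeasure lborel {w :: real ^ 'm. norm w \<le> 1 \<and> \<rho> * norm w \<le> w $ i \<and> 0 < w $ i}"
proof -
  interpret product_sigma_finite "\<lambda>_::'m. lborel :: real measure" ..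
  let ?E = "{w :: real ^ 'm. norm w \<le> 1 \<and> \<rho> * norm w \<le> w $ i \<and> 0 < w $ i}"
  define b where "b = (\<lambda>x. min (x / \<rho>) ((1 - x) / (1 - \<rho>)))"
  have [measurable]: "b \<in> borel_measurable borel" unfolding b_def by measurable
  define J where "J = - {i}"
  have J: "finite J" "i \<notin> J" "insert i J = UNIV" "card J = d" unfolding J_def using d by (auto simp: Compl_eq_Diff_UNIV)
  let ?T = "\<lambda>g. (\<Sum>j\<in>UNIV. g j *\<^sub>R axis j 1) :: real ^ 'm"
  have T: "?T g $ j = g j" for g j by (simp add: axis_def if_distrib cong: if_cong)
  have Tm[measurable]: "?T \<in> borel_measurable (PiM UNIV (\<lambda>_. lborel))" by measurable
  have lb: "(lborel :: (real ^ 'm) measure) = distr (PiM UNIV (\<lambda>_. lborel)) borel ?T"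
    by (rule lborel_eq_distr_PiM_basis[OF finite bij_betw_axis])
  have [measurable]: "(\<lambda>w :: real ^ 'm. w $ i) \<in> borel_measurable borel"
    by (intro borel_measurable_continuous_onI continuous_intros)
  have E[measurable]: "?E \<in> sets borel" by measurable
  have nT: "norm (?T (g(i := x))) = sqrt (x\<^sup>2 + (sqrt (\<Sum>j\<in>J. (g j)\<^sup>2))\<^sup>2)" for g x
  proof -
    have "norm (?T (g(i := x))) = sqrt (\<Sum>j\<in>UNIV. (?T (g(i := x)) $ j)\<^sup>2)"
      by (simp add: norm_vec_def L2_set_def)
    also have "\<dots> = sqrt (\<Sum>j\<in>insert i J. ((g(i := x)) j)\<^sup>2)" unfolding T J(3) ..
    also have "(\<Sum>j\<in>insert i J. ((g(i := x)) j)\<^sup>2) = x\<^sup>2 + (\<Sum>j\<in>J. (g j)\<^sup>2)"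
      using J(1,2) by (subst sum.insert) (auto intro!: sum.cong)
    also have "(\<Sum>j\<in>J. (g j)\<^sup>2) = (sqrt (\<Sum>j\<in>J. (g j)\<^sup>2))\<^sup>2" by (simp add: sum_nonneg)
    finally show ?thesis .
  qed
  have "ennreal (unit_ball_vol (real d) * sqrt (1 - \<rho>\<^sup>2) ^ d / real (d + 1))
     = ennreal (unit_ball_vol (real d) * sqrt (1 - \<rho>\<^sup>2) ^ d) * ennreal (1 / real (d + 1))"
    using \<rho> by (simp add: ennreal_mult[symmetric] power_le_one)
  also have "ennreal (1 / real (d + 1)) = (\<integral>\<^sup>+x. ennreal (b x ^ d) * indicator {0..1} x \<partial>lborel)"
  proof -
    have bi: "((\<lambda>x. b x ^ d) has_integral (1 / real (d + 1))) {0..1}"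
      unfolding b_def by (rule has_integral_bicone_profile[OF \<rho>])
    have bn: "0 \<le> b x ^ d" if "x \<in> {0..1}" for x using that \<rho> unfolding b_def by auto
    show ?thesis by (rule nn_integral_has_integral_lebesgue'[OF bn bi, symmetric])
  qed
  also have "ennreal (unit_ball_vol (real d) * sqrt (1 - \<rho>\<^sup>2) ^ d) * (\<integral>\<^sup>+x. ennreal (b x ^ d) * indicator {0..1} x \<partial>lborel)
     = (\<integral>\<^sup>+x. ennreal (unit_ball_vol (real d) * sqrt (1 - \<rho>\<^sup>2) ^ d) * (ennreal (b x ^ d) * indicator {0..1} x) \<partial>lborel)"
    by (intro nn_integral_cmult[symmetric]) measurable
  also have "\<dots> \<le> (\<integral>\<^sup>+x. (\<integral>\<^sup>+g. indicator ?E (?T (g(i := x))) \<partial>PiM J (\<lambda>_. lborel)) \<partial>lborel)"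
  proof (intro nn_integral_mono)
    fix x :: real
    show "ennreal (unit_ball_vol (real d) * sqrt (1 - \<rho>\<^sup>2) ^ d) * (ennreal (b x ^ d) * indicator {0..1} x)
      \<le> (\<integral>\<^sup>+g. indicator ?E (?T (g(i := x))) \<partial>PiM J (\<lambda>_. lborel))"
    proof (cases "0 < x \<and> x < 1")
      case False
      \<comment> \<open>At the endpoints 0 and 1 the radius vanishes, and \<open>0 ^ d\<close> is 0
        because d >= 1.\<close>
      then have "x \<notin> {0..1} \<or> b x = 0" using \<rho> unfolding b_def by (auto simp: min_def)
      then have z: "ennreal (b x ^ d) * indicator {0..1} x = 0" using d(2) by auto
      show ?thesis unfolding z by simp
    next
      case True
      have bx: "b x > 0" unfolding b_def using True \<rho> by auto
      define r where "r = sqrt (1 - \<rho>\<^sup>2) * b x"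
      have "\<rho>\<^sup>2 < 1" using \<rho> by (simp add: power_less_one_iff)
      then have r: "r > 0" unfolding r_def using bx by simp
      let ?B = "{f. sqrt (\<Sum>j\<in>J. (f j)\<^sup>2) \<le> r} \<inter> space (PiM J (\<lambda>_. lborel :: real measure))"
      have Bm: "?B \<in> sets (PiM J (\<lambda>_. lborel))"
      proof -
        have "{f \<in> space (PiM J (\<lambda>_. lborel :: real measure)). sqrt (\<Sum>j\<in>J. (f j)\<^sup>2) \<le> r} \<in> sets (PiM J (\<lambda>_. lborel))"
          by measurable
        then show ?thesis by (simp add: Int_def conj_commute)
      qed
      have "ennreal (unit_ball_vol (real d) * sqrt (1 - \<rho>\<^sup>2) ^ d) * (ennreal (b x ^ d) * indicator {0..1} x)
          = ennreal (unit_ball_vol (real (card J)) * r ^ card J)"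
        using True bx \<open>\<rho>\<^sup>2 < 1\<close> unfolding r_def J(4) by (simp add: ennreal_mult[symmetric] power_mult_distrib mult_ac)
      also have "\<dots> = emeasure (PiM J (\<lambda>_. lborel)) ?B"
        by (rule emeasure_cball_aux[OF J(1) r, symmetric])
      also have "\<dots> = (\<integral>\<^sup>+g. indicator ?B g \<partial>PiM J (\<lambda>_. lborel))" using Bm by simp
      also have "\<dots> \<le> (\<integral>\<^sup>+g. indicator ?E (?T (g(i := x))) \<partial>PiM J (\<lambda>_. lborel))"
      proof (intro nn_integral_mono)
        fix g :: "'m \<Rightarrow> real"
        have "?T (g(i := x)) \<in> ?E" if "g \<in> ?B"
        proof -
          have w: "0 \<le> sqrt (\<Sum>j\<in>J. (g j)\<^sup>2)" "sqrt (\<Sum>j\<in>J. (g j)\<^sup>2) \<le> sqrt (1 - \<rho>\<^sup>2) * min (x / \<rho>) ((1 - x) / (1 - \<rho>))"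
            using that unfolding r_def b_def by (auto intro: sum_nonneg)
          show ?thesis
            using bicone_subset_cap[OF \<rho> _ _ w] True T[of "g(i := x)" i] unfolding mem_Collect_eq nT by simp
        qed
        then show "indicator ?B g \<le> (indicator ?E (?T (g(i := x))) :: ennreal)" by (auto simp: indicator_def)
      qed
      finally show ?thesis .
    qed
  qed
  also have "\<dots> = (\<integral>\<^sup>+g. indicator ?E (?T g) \<partial>PiM (insert i J) (\<lambda>_. lborel))"
    using Tm E by (intro product_nn_integral_insert_rev[symmetric] J(1,2)) (simp add: J(3))
  also have "\<dots> = emeasure (distr (PiM UNIV (\<lambda>_. lborel)) borel ?T) ?E"
    unfolding J(3) using Tm E by (simp add: nn_integral_distr flip: nn_integral_indicator)
  also have "\<dots> = emeasure lborel ?E" by (rule arg_cong[OF lb[symmetric], of "\<lambda>M. emeasure M ?E"])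
  finally show ?thesis .
qed

text \<open>The absolute value admits the caps around y and around -y, which doubles the volume
  gained.\<close>

lemma emeasure_cap:
  fixes y :: "real ^ 'm"
  assumes y: "norm y = 1" and m: "CARD('m) = d + 1" and \<rho>: "0 < \<rho>" "\<rho> \<le> 1" "d = 0 \<or> \<rho> < 1"
  shows "ennreal (2 * unit_ball_vol (real d) * sqrt (1 - \<rho>\<^sup>2) ^ d / real (d + 1))
    \<le> emeasure lborel {u. norm u \<le> 1 \<and> \<rho> * norm u \<le> \<bar>y \<bullet> u\<bar>}"
proof -
  obtain i :: 'm where True by simp
  have ny: "norm y = norm (axis i 1 :: real ^ 'm)" using y by simp
  obtain f :: "real ^ 'm \<Rightarrow> real ^ 'm" where f: "orthogonal_transformation f" "f y = axis i 1"
    using orthogonal_transformation_exists[OF ny] by auto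
  have [measurable]: "f \<in> borel_measurable borel"
    by (intro borel_measurable_continuous_onI linear_continuous_on linear_conv_bounded_linear[THEN iffD1]
      orthogonal_transformation_linear f(1))
  have coord[measurable]: "(\<lambda>w :: real ^ 'm. w $ i) \<in> borel_measurable borel"
    by (intro borel_measurable_continuous_onI continuous_intros)
  let ?E = "{w :: real ^ 'm. norm w \<le> 1 \<and> \<rho> * norm w \<le> \<bar>w $ i\<bar>}"
  have E: "?E \<in> sets borel" by measurable
  have "y \<bullet> u = f u $ i" for u
  proof -
    have "y \<bullet> u = f y \<bullet> f u" using f(1) by (simp add: orthogonal_transformation_def)
    then show ?thesis unfolding f(2) by (simp add: inner_axis inner_commute)
  qed
  then have "{u. norm u \<le> 1 \<and> \<rho> * norm u \<le> \<bar>y \<bullet> u\<bar>} = f -` ?E"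
    using f(1) by (auto simp: orthogonal_transformation_norm)
  then have "emeasure lborel {u. norm u \<le> 1 \<and> \<rho> * norm u \<le> \<bar>y \<bullet> u\<bar>} = emeasure (distr lborel borel f) ?E"
    using E by (simp add: emeasure_distr)
  then have eq: "emeasure lborel {u. norm u \<le> 1 \<and> \<rho> * norm u \<le> \<bar>y \<bullet> u\<bar>} = emeasure lborel ?E"
    unfolding lborel_distr_orthogonal[OF f(1)] .
  show ?thesis
  proof (cases "d = 0")
    \<comment> \<open>The zeroth power is 1 even at \<rho> = 1, so the left side is 2, the length of
      the interval [-1, 1].\<close>
    case True
    then have "CARD('m) = 1" using m by simp
    then obtain j where "UNIV = {j :: 'm}" by (metis card_1_singletonE)
    then have U: "UNIV = {i}" by (metis UNIV_I singletonD)
    have "norm w = \<bar>w $ i\<bar>" for w :: "real ^ 'm" by (simp add: norm_vec_def L2_set_def U)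
    then have "?E = cball 0 1" using \<rho> by (auto simp: mult_left_le_one_le)
    then have "emeasure lborel ?E = ennreal (unit_ball_vol 1)"
      using m True by (simp add: emeasure_cball)
    then show ?thesis unfolding eq using True by simp
  next
    case False
    then have \<rho>1: "\<rho> < 1" and d: "1 \<le> d" using \<rho> by auto
    let ?P = "{w :: real ^ 'm. norm w \<le> 1 \<and> \<rho> * norm w \<le> w $ i \<and> 0 < w $ i}"
    let ?N = "{w :: real ^ 'm. norm w \<le> 1 \<and> \<rho> * norm w \<le> - w $ i \<and> 0 < - w $ i}"
    have PN: "?P \<in> sets borel" "?N \<in> sets borel" by measurable
    have un: "orthogonal_transformation (uminus :: real ^ 'm \<Rightarrow> real ^ 'm)"
      by (simp add: orthogonal_transformation_def linear_iff)
    have "?N = uminus -` ?P" by auto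
    then have "emeasure lborel ?N = emeasure (distr lborel borel uminus) ?P"
      using PN by (simp add: emeasure_distr)
    then have N: "emeasure lborel ?N = emeasure lborel ?P" unfolding lborel_distr_orthogonal[OF un] .
    have "ennreal (2 * unit_ball_vol (real d) * sqrt (1 - \<rho>\<^sup>2) ^ d / real (d + 1))
      = ennreal (unit_ball_vol (real d) * sqrt (1 - \<rho>\<^sup>2) ^ d / real (d + 1)) + ennreal (unit_ball_vol (real d) * sqrt (1 - \<rho>\<^sup>2) ^ d / real (d + 1))"
      using \<rho> by (subst ennreal_plus[symmetric]) (auto simp: power_le_one)
    also have "\<dots> \<le> emeasure lborel ?P + emeasure lborel ?N"
      unfolding N using emeasure_half_cap[OF m d \<rho>(1) \<rho>1, of i] by (intro add_mono)
    also have "\<dots> = emeasure lborel (?P \<union> ?N)"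
      using PN by (intro plus_emeasure) auto
    also have "\<dots> \<le> emeasure lborel ?E" using E by (intro emeasure_mono) auto
    finally show ?thesis unfolding eq .
  qed
qed

text \<open>Pairs (A, u) are counted in two ways: each A with a small singular value has a witness y
  and hence at least a double cap of admissible u, while for fixed u the admissible A are bounded by
  \<open>emeasure_gaussian_tilted\<close>. The witness is used for one A at a time, so no measurable
  selection of y arises.\<close>

theorem emeasure_small_singular:
  fixes c :: "real ^ 'n ^ 'm"
  assumes k: "CARD('m) + k = CARD('n) + 1" and s: "0 < s" and \<tau>: "0 < \<tau>"
    and m: "CARD('m) = d + 1" and \<rho>: "0 < \<rho>" "\<rho> \<le> 1" "d = 0 \<or> \<rho> < 1"
  shows "emeasure (gaussian c s) (small_singular \<tau>) * ennreal (2 * unit_ball_vol (real d) * sqrt (1 - \<rho>\<^sup>2) ^ d / real (d + 1))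
    \<le> ennreal (unit_ball_vol (real k) * (\<tau> / \<rho> / (sqrt (2 * pi) * s)) ^ k * unit_ball_vol (real (d + 1)))"
    (is "_ * ?p \<le> _")
proof -
  let ?G = "gaussian c s"
  let ?K = "ennreal (unit_ball_vol (real k) * (\<tau> / \<rho> / (sqrt (2 * pi) * s)) ^ k)"
  interpret G: prob_space ?G using s by (rule prob_space_gaussian)
  interpret P: pair_sigma_finite ?G lborel ..
  let ?h = "\<lambda>A u :: real ^ 'm. indicator (tilted \<tau> \<rho>) (A, u) * indicator (cball 0 1) u :: ennreal"
  have "sets (?G \<Otimes>\<^sub>M (lborel :: (real ^ 'm) measure)) = sets (borel \<Otimes>\<^sub>M borel)" by (intro sets_pair_measure_cong) simp_all
  then have sp: "sets (?G \<Otimes>\<^sub>M (lborel :: (real ^ 'm) measure)) = sets borel" unfolding borel_prod .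
  have [measurable]: "tilted \<tau> \<rho> \<in> sets (?G \<Otimes>\<^sub>M lborel)"
    unfolding sp by (rule borel_closed[OF closed_tilted])
  have [measurable]: "cball (0 :: real ^ 'm) 1 \<in> sets borel" by simp
  have sm: "small_singular \<tau> \<in> sets (borel :: (real ^ 'n ^ 'm) measure)" by (intro borel_closed closed_small_singular)
  have "emeasure ?G (small_singular \<tau>) * ?p = (\<integral>\<^sup>+A. indicator (small_singular \<tau>) A * ?p \<partial>?G)"
    using sm by (simp add: nn_integral_multc)
  also have "\<dots> \<le> (\<integral>\<^sup>+A. (\<integral>\<^sup>+u. ?h A u \<partial>lborel) \<partial>?G)"
  proof (intro nn_integral_mono)
    fix A :: "real ^ 'n ^ 'm"
    show "indicator (small_singular \<tau>) A * ?p \<le> (\<integral>\<^sup>+u. ?h A u \<partial>lborel)"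
    proof (cases "A \<in> small_singular \<tau>")
      case True
      then obtain y where y: "norm y = 1" "norm (y v* A) \<le> \<tau>" unfolding small_singular_def by auto
      let ?C = "{u. norm u \<le> 1 \<and> \<rho> * norm u \<le> \<bar>y \<bullet> u\<bar>}"
      have C: "?C \<in> sets lborel" by measurable
      have "?p \<le> emeasure lborel ?C" using emeasure_cap[OF y(1) m \<rho>] .
      also have "\<dots> = (\<integral>\<^sup>+u. indicator ?C u \<partial>lborel)" using C by simp
      also have "\<dots> \<le> (\<integral>\<^sup>+u. ?h A u \<partial>lborel)"
        using y by (intro nn_integral_mono) (auto simp: indicator_def tilted_def)
      finally show ?thesis using True by simp
    qed simp
  qed
  also have "\<dots> = (\<integral>\<^sup>+u. (\<integral>\<^sup>+A. ?h A u \<partial>?G) \<partial>lborel)"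
    by (intro P.Fubini'[symmetric]) measurable
  also have "\<dots> \<le> (\<integral>\<^sup>+u. ?K * indicator (cball 0 1) u \<partial>(lborel :: (real ^ 'm) measure))"
  proof (rule nn_integral_mono_AE)
    \<comment> \<open>At u = 0 the angle condition is void and the section is all of
      \<open>small_singular\<close>; this single point is discarded.\<close>
    have "AE u in lborel. u \<noteq> (0 :: real ^ 'm)" by (rule AE_lborel_singleton)
    then show "AE u in lborel. (\<integral>\<^sup>+A. ?h A u \<partial>?G) \<le> ?K * indicator (cball 0 1) (u :: real ^ 'm)"
    proof eventually_elim
      case (elim u)
      have cl: "closed {A :: real ^ 'n ^ 'm. (A, u) \<in> tilted \<tau> \<rho>}"
        using closed_vimage[OF closed_tilted[of \<tau> \<rho>], of "\<lambda>A. (A, u)"]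
        by (simp add: vimage_def continuous_on_Pair)
      have "(\<integral>\<^sup>+A. ?h A u \<partial>?G) = (\<integral>\<^sup>+A. indicator {A. (A, u) \<in> tilted \<tau> \<rho>} A * indicator (cball 0 1) u \<partial>?G)"
        by (intro nn_integral_cong) (simp add: indicator_def)
      also have "\<dots> = emeasure ?G {A. (A, u) \<in> tilted \<tau> \<rho>} * indicator (cball 0 1) u"
        using cl by (simp add: nn_integral_multc)
      also have "\<dots> \<le> ?K * indicator (cball 0 1) u"
        using emeasure_gaussian_tilted[OF k s \<tau> \<rho>(1) elim, of c] by (rule mult_right_mono) simp
      finally show ?case .
    qed
  qed
  also have "\<dots> = ?K * emeasure lborel (cball (0 :: real ^ 'm) 1)" by (simp add: nn_integral_cmult)
  also have "emeasure lborel (cball (0 :: real ^ 'm) 1) = ennreal (unit_ball_vol (real (d + 1)))"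
    using m by (simp add: emeasure_cball)
  also have "?K * \<dots> = ennreal (unit_ball_vol (real k) * (\<tau> / \<rho> / (sqrt (2 * pi) * s)) ^ k * unit_ball_vol (real (d + 1)))"
    using s \<tau> \<rho> by (simp add: ennreal_mult)
  finally show ?thesis .
qed

section \<open>Estimates for the constants\<close>

lemma exp_one_ge: "(13/8)\<^sup>2 \<le> exp (1::real)"
proof -
  \<comment> \<open>13/8 is the quadratic Taylor value 1 + 1/2 + 1/8 of exp at 1/2. Its eighth power
    just exceeds 48, as the bound on \<open>exp 4\<close> in \<open>ln_Gamma_ge\<close>
    requires.\<close>
  have "13/8 \<le> exp (1/2 :: real)" using exp_lower_Taylor_quadratic[of "1/2"] by (simp add: power2_eq_square)
  then have "(13/8)\<^sup>2 \<le> (exp (1/2 :: real))\<^sup>2" by (intro power_mono) auto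
  then show ?thesis by (simp add: exp_double[symmetric])
qed

lemma Gamma_add_one:
  fixes x :: real
  assumes "0 < x"
  shows "Gamma (x + 1) = x * Gamma x"
  using assms by (intro Gamma_plus1) (auto elim!: nonpos_Ints_cases)

text \<open>The factor \<open>sqrt (x + 1)\<close> in place of Stirling's \<open>sqrt x\<close> makes the quotient of the two
  sides increase along \<open>x \<mapsto> x + 1\<close>.\<close>

lemma ln_Gamma_step:
  fixes x a :: real
  assumes x: "0 < x" and "x * ln x - x + ln (x + 1) / 2 + a \<le> ln (Gamma (x + 1))"
  shows "(x + 1) * ln (x + 1) - (x + 1) + ln (x + 2) / 2 + a \<le> ln (Gamma (x + 2))"
proof -
  \<comment> \<open>The trapezoid bound for the integral of 1/t leaves a slack of 1 / (2 (x + 1)),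
    exactly what half of \<open>ln (x + 2) - ln (x + 1)\<close> may use.\<close>
  have "ln (x + 1) - ln x \<le> 1 * (inverse x + inverse (x + 1)) / 2"
    using ln_inverse_approx_le[of x 1] x by simp
  then have "x * (ln (x + 1) - ln x) \<le> x * (1 * (inverse x + inverse (x + 1)) / 2)"
    using x by (intro mult_left_mono) auto
  also have "\<dots> = 1 - 1 / (x + 1) / 2" using x by (simp add: divide_simps)
  finally have 1: "x * (ln (x + 1) - ln x) \<le> 1 - 1 / (x + 1) / 2" .
  have "ln ((x + 2) / (x + 1)) \<le> (x + 2) / (x + 1) - 1" using x by (intro ln_le_minus_one) auto
  then have 2: "ln (x + 2) - ln (x + 1) \<le> 1 / (x + 1)" using x by (simp add: ln_div field_simps)
  have "Gamma (x + 2) = (x + 1) * Gamma (x + 1)"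
    using Gamma_add_one[of "x + 1"] x by (simp add: add.assoc)
  then have "ln (Gamma (x + 2)) = ln (x + 1) + ln (Gamma (x + 1))"
    using x by (simp add: ln_mult_pos Gamma_real_pos)
  moreover define y where "y = 1 / (x + 1)"
  ultimately show ?thesis using assms(2) 1 2 unfolding y_def[symmetric] by (simp add: algebra_simps)
qed

text \<open>One step in x = k / 2 is two steps in k, hence two base cases. For k = 1 the inequality
  is false.\<close>

lemma ln_Gamma_ge:
  fixes k :: nat
  assumes "3 \<le> k"
  shows "real k / 2 * ln (real k / 2) - real k / 2 + ln (real k / 2 + 1) / 2 + ln pi / 2 \<le> ln (Gamma (real k / 2 + 1))"
  using assms
proof (induction k rule: less_induct)
  case (less k)
  have e: "(13/8)\<^sup>2 \<le> exp (1::real)" by (rule exp_one_ge)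
  consider "k = 3" | "k = 4" | "5 \<le> k" using less.prems by linarith
  then show ?case
  proof cases
    case 1
    have g: "Gamma (5/2 :: real) = 3/4 * sqrt pi"
      using Gamma_add_one[of "3/2"] Gamma_add_one[of "1/2"] by (simp add: Gamma_one_half_real)
    have "real k / 2 + 1 = 5/2" using 1 by simp
    then have "ln (Gamma (real k / 2 + 1)) = ln (3/4 * sqrt pi)" by (simp only: g)
    also have "\<dots> = ln (3/4) + ln (sqrt pi)" by (intro ln_mult_pos) auto
    finally have G: "ln (Gamma (real k / 2 + 1)) = ln 3 - ln 4 + ln pi / 2" by (simp add: ln_div ln_sqrt)
    have "((13/8)\<^sup>2) ^ 3 \<le> exp (1::real) ^ 3" using e by (intro power_mono) auto
    then have "(15::real) \<le> exp 3" by (simp add: exp_of_nat_mult[of 3 1, simplified, symmetric] power_divide)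
    \<comment> \<open>After doubling, the case k = 3 reduces to ln 3 + ln 5 <= 3.\<close>
    then have "ln 15 \<le> (3::real)" using ln_le_cancel_iff[of 15 "exp 3"] by simp
    moreover have "ln (15::real) = ln 3 + ln 5" using ln_mult_pos[of "3::real" 5] by simp
    moreover have "ln (4::real) = 2 * ln 2" using ln_mult_pos[of "2::real" 2] by simp
    ultimately show ?thesis unfolding G using 1 by (simp add: ln_div field_simps)
  next
    case 2
    have "Gamma (3 :: real) = 2" using Gamma_fact[of 2, where 'a = real] by (simp add: numeral_eq_Suc)
    then have G: "ln (Gamma (real k / 2 + 1)) = ln 2" using 2 by simp
    have "((13/8)\<^sup>2) ^ 4 \<le> exp (1::real) ^ 4" using e by (intro power_mono) auto
    then have "(48::real) \<le> exp 4" by (simp add: exp_of_nat_mult[of 4 1, simplified, symmetric] power_divide)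
    moreover have "12 * pi \<le> 48" using pi_less_4 by simp
    ultimately have "12 * pi \<le> exp 4" by linarith
    \<comment> \<open>After doubling, the case k = 4 reduces to this inequality, and
      \<open>pi < 4\<close> is precise enough for it.\<close>
    then have "ln (12 * pi) \<le> 4" using ln_le_cancel_iff[of "12 * pi" "exp 4"] by simp
    moreover have "ln (12 * pi) = 2 * ln 2 + ln 3 + ln pi"
      using ln_mult_pos[of 12 pi] ln_mult_pos[of "4::real" 3] ln_mult_pos[of "2::real" 2] by simp
    ultimately show ?thesis unfolding G using 2 by simp
  next
    case 3
    define x where "x = real (k - 2) / 2"
    have "x * ln x - x + ln (x + 1) / 2 + ln pi / 2 \<le> ln (Gamma (x + 1))"
      unfolding x_def using 3 by (intro less.IH) auto
    then have "(x + 1) * ln (x + 1) - (x + 1) + ln (x + 2) / 2 + ln pi / 2 \<le> ln (Gamma (x + 2))"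
      using 3 by (intro ln_Gamma_step) (simp_all add: x_def)
    moreover have "real k / 2 + 1 = x + 2" "real k / 2 = x + 1" unfolding x_def using 3 by (simp_all add: field_simps of_nat_diff)
    ultimately show ?thesis by (simp only:)
  qed
qed

text \<open>A Stirling bound of the strength that c(\<lambda>) permits: with \<lambda> = (m - 1) /
  (m + k - 1) the square root equals c(\<lambda>) sqrt (2 / (pi m)). For k = 1 the right side is
  smallest at m = 1, where e >= 2 suffices.\<close>

lemma powr_le_Gamma:
  fixes k m :: nat
  assumes k: "1 \<le> k" and m: "1 \<le> m"
  shows "(real k / (2 * exp 1)) powr (real k / 2)
    \<le> Gamma (real k / 2 + 1) * sqrt ((real k + 2 * real m - 2) / (pi * real k * real m))"
proof -
  consider "k = 1" | "k = 2" | "3 \<le> k" using k by linarith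
  then show ?thesis
  proof cases
    case 1
    have g: "Gamma (3/2 :: real) = sqrt pi / 2"
      using Gamma_add_one[of "1/2"] by (simp add: Gamma_one_half_real)
    have "real k / 2 + 1 = 3/2" using 1 by simp
    then have "Gamma (real k / 2 + 1) * sqrt ((real k + 2 * real m - 2) / (pi * real k * real m))
        = sqrt pi / 2 * sqrt ((2 * real m - 1) / (pi * real m))" using 1 by (simp only: g) simp
    also have "\<dots> = sqrt ((2 * real m - 1) / (4 * real m))"
      using m by (simp add: real_sqrt_divide real_sqrt_mult)
    finally have "Gamma (real k / 2 + 1) * sqrt ((real k + 2 * real m - 2) / (pi * real k * real m)) = sqrt ((2 * real m - 1) / (4 * real m))" .
    moreover have "1 / (2 * exp 1) \<le> (2 * real m - 1) / (4 * real m)"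
    proof -
      have "2 * real m \<le> (2 * real m - 1) * 2" using m by simp
      also have "\<dots> \<le> (2 * real m - 1) * exp 1" using m exp_one_ge by (intro mult_left_mono) (auto simp: power2_eq_square)
      finally show ?thesis using m by (simp add: field_simps)
    qed
    ultimately show ?thesis using 1 by (simp add: powr_half_sqrt)
  next
    case 2
    have "2 \<le> exp (1::real)" using exp_one_ge by (simp add: power2_eq_square)
    then have "(2::real)\<^sup>2 \<le> (exp 1)\<^sup>2" by (intro power_mono) auto
    then have "pi \<le> (exp 1)\<^sup>2" using pi_less_4 by simp
    have "Gamma (2 :: real) = 1" using Gamma_fact[of 1, where 'a = real] by simp
    moreover have "sqrt pi \<le> exp 1" using \<open>pi \<le> (exp 1)\<^sup>2\<close> by (intro real_le_lsqrt) auto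
    then have "1 / exp 1 \<le> 1 / sqrt pi" by (intro divide_left_mono) auto
    ultimately show ?thesis using 2 m by (simp add: real_sqrt_divide)
  next
    case 3
    define x where "x = real k / 2"
    have x: "x > 0" using 3 unfolding x_def by simp
    have "exp (x * ln x - x + ln (x + 1) / 2 + ln pi / 2) \<le> exp (ln (Gamma (x + 1)))"
      using ln_Gamma_ge[OF 3] unfolding x_def by (simp only: exp_le_cancel_iff)
    then have "exp (x * (ln x - 1)) * (exp (ln (x + 1) / 2) * exp (ln pi / 2)) \<le> Gamma (x + 1)"
      using x by (simp add: Gamma_real_pos exp_add[symmetric] algebra_simps)
    moreover have "exp (ln (x + 1) / 2) = sqrt (x + 1)" "exp (ln pi / 2) = sqrt pi"
      using x by (simp_all add: ln_sqrt[symmetric])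
    moreover have "exp (x * (ln x - 1)) = (real k / (2 * exp 1)) powr (real k / 2)"
      using 3 x unfolding powr_def x_def by (simp add: ln_div ln_mult_pos)
    ultimately have G: "(real k / (2 * exp 1)) powr (real k / 2) * (sqrt (x + 1) * sqrt pi) \<le> Gamma (x + 1)" by simp
    have "1 / (pi * (x + 1)) \<le> (real k + 2 * real m - 2) / (pi * real k * real m)"
    proof -
      have "1 / (pi * (x + 1)) \<le> 1 / (pi * x)" using x by (intro divide_left_mono mult_left_mono) auto
      also have "\<dots> = 2 * real m / (pi * real k * real m)" using m x unfolding x_def by simp
      also have "\<dots> \<le> (real k + 2 * real m - 2) / (pi * real k * real m)" using 3 by (intro divide_right_mono) auto
      finally show ?thesis .
    qed
    then have s: "1 / (sqrt (x + 1) * sqrt pi) \<le> sqrt ((real k + 2 * real m - 2) / (pi * real k * real m))"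
      by (metis real_sqrt_le_iff real_sqrt_divide real_sqrt_mult real_sqrt_one mult.commute)
    have "(real k / (2 * exp 1)) powr (real k / 2) \<le> Gamma (x + 1) * (1 / (sqrt (x + 1) * sqrt pi))"
      using G x by (simp add: field_simps)
    also have "\<dots> \<le> Gamma (x + 1) * sqrt ((real k + 2 * real m - 2) / (pi * real k * real m))"
      using s x by (intro mult_left_mono) (auto simp: Gamma_real_nonneg)
    finally show ?thesis unfolding x_def .
  qed
qed

text \<open>Log-convexity of Gamma at the midpoint of x and x + 1.\<close>

lemma Gamma_half_shift_le:
  fixes x :: real
  assumes x: "0 < x"
  shows "Gamma (x + 1/2) \<le> sqrt x * Gamma x"
proof -
  have "(ln \<circ> Gamma) ((1 - 1/2) *\<^sub>R x + (1/2) *\<^sub>R (x + 1)) \<le> (1 - 1/2) * (ln \<circ> Gamma) x + (1/2) * (ln \<circ> Gamma) (x + 1)"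
    using x by (intro convex_onD[OF log_convex_Gamma_real]) auto
  moreover have "(1 - 1/2) *\<^sub>R x + (1/2) *\<^sub>R (x + 1) = x + 1/2" by (simp add: field_simps)
  ultimately have "ln (Gamma (x + 1/2)) \<le> ln (Gamma x) / 2 + ln (Gamma (x + 1)) / 2" by simp
  also have "Gamma (x + 1) = x * Gamma x" by (rule Gamma_add_one[OF x])
  also have "ln (Gamma x) / 2 + ln (x * Gamma x) / 2 = ln (sqrt x * Gamma x)"
    using x by (simp add: ln_mult_pos ln_sqrt Gamma_real_pos add_divide_distrib)
  finally show ?thesis using x by (subst (asm) ln_le_cancel_iff) (auto simp: Gamma_real_pos)
qed

text \<open>This compares the leading factor of the double cap volume with the volume of the unit
  ball. With x = (d + 1) / 2 the powers of pi differ by sqrt pi, and the claim becomes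
  \<open>Gamma_half_shift_le\<close>.\<close>

lemma unit_ball_vol_ratio:
  fixes d :: nat
  shows "unit_ball_vol (real (d + 1)) * sqrt (2 / (pi * real (d + 1))) \<le> 2 * unit_ball_vol (real d) / real (d + 1)"
proof -
  define x where "x = real (d + 1) / 2"
  have x: "x > 0" unfolding x_def by simp
  have G: "Gamma (x + 1/2) \<le> sqrt x * Gamma x" by (rule Gamma_half_shift_le[OF x])
  have G1: "Gamma (x + 1) = x * Gamma x" by (rule Gamma_add_one[OF x])
  have pos: "Gamma (x + 1/2) > 0" "Gamma x > 0" using x by (auto intro: Gamma_real_pos)
  have v1: "unit_ball_vol (real (d + 1)) = pi powr x / (x * Gamma x)"
    unfolding unit_ball_vol_def x_def[symmetric] G1 ..
  have h: "real d / 2 + 1 = x + 1/2" "real d / 2 = x - 1/2" unfolding x_def by (simp_all add: field_simps)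
  have v0: "unit_ball_vol (real d) = pi powr x / (sqrt pi * Gamma (x + 1/2))"
    unfolding unit_ball_vol_def h(1) unfolding h(2) powr_diff by (simp add: powr_half_sqrt)
  have sq: "sqrt (2 / (pi * real (d + 1))) = 1 / (sqrt pi * sqrt x)"
    unfolding x_def by (simp add: real_sqrt_divide real_sqrt_mult)
  have "unit_ball_vol (real (d + 1)) * sqrt (2 / (pi * real (d + 1))) = pi powr x / sqrt pi / x * (1 / (sqrt x * Gamma x))"
    unfolding v1 sq using x by simp
  also have "\<dots> \<le> pi powr x / sqrt pi / x * (1 / Gamma (x + 1/2))"
    using G x pos by (intro mult_left_mono divide_left_mono) auto
  also have "\<dots> = 2 * unit_ball_vol (real d) / real (d + 1)" unfolding v0 unfolding x_def by (simp add: mult_ac)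
  finally show ?thesis .
qed

text \<open>The right side is the cap factor (1 - \<rho>^2)^(d/2) for \<rho>^2 = k / (d + k). The
  bound comes down to ln (1 + k / d) <= k / d; for d = 0 the power is 1.\<close>

lemma exp_le_sqrt_ratio_power:
  fixes d k :: nat
  assumes "1 \<le> k"
  shows "exp (- real k / 2) \<le> sqrt (real d / real (d + k)) ^ d"
proof (cases "d = 0")
  case False
  define q where "q = real d / real (d + k)"
  have q: "q > 0" unfolding q_def using False by simp
  have "ln (real (d + k) / real d) \<le> real (d + k) / real d - 1" using False by (intro ln_le_minus_one) auto
  then have "real d * ln (real (d + k) / real d) \<le> real d * (real (d + k) / real d - 1)" by (intro mult_left_mono) auto
  also have "\<dots> = real k" using False by (simp add: field_simps)
  finally have "- real k \<le> real d * ln q" unfolding q_def using False by (simp add: ln_div algebra_simps)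
  then have "exp (- real k / 2) \<le> exp (real d * (ln q / 2))" by simp
  also have "\<dots> = sqrt q ^ d" using q by (simp add: exp_of_nat_mult ln_sqrt[symmetric])
  finally show ?thesis unfolding q_def .
qed simp

text \<open>All constants meet here. Of the factor e^(-k) on the left, one half is spent on
  \<open>powr_le_Gamma\<close> and the other on \<open>exp_le_sqrt_ratio_power\<close>; after
  \<open>unit_ball_vol_ratio\<close> what remains is c(\<lambda>) with \<lambda> = d / (d +
  k).\<close>

lemma cap_constant_le:
  fixes d k :: nat
  assumes k: "1 \<le> k"
  shows "unit_ball_vol (real k) * (sqrt (real k) / (exp 1 * sqrt (2 * pi))) ^ k * unit_ball_vol (real (d + 1))
    \<le> c_fun (real d / real (d + k)) * (2 * unit_ball_vol (real d) * sqrt (real d / real (d + k)) ^ d / real (d + 1))"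
proof -
  let ?m = "real (d + 1)"
  define c where "c = c_fun (real d / real (d + k))"
  have "1 - real d / real (d + k) = real k / real (d + k)" "1 + real d / real (d + k) = (real k + 2 * ?m - 2) / real (d + k)"
    using k by (simp_all add: field_simps)
  then have c: "c = sqrt ((real k + 2 * ?m - 2) / (2 * real k))"
    unfolding c_def c_fun_def using k by simp
  have c0: "c \<ge> 0" unfolding c by simp
  have sp: "sqrt ((real k + 2 * ?m - 2) / (pi * real k * ?m)) = c * sqrt (2 / (pi * ?m))"
    unfolding c real_sqrt_mult[symmetric] using k by (simp add: divide_simps) (simp add: algebra_simps)
  have Gp: "Gamma (real k / 2 + 1) > 0" by (intro Gamma_real_pos) (simp add: add_nonneg_pos)
  have "(sqrt (real k) / (exp 1 * sqrt (2 * pi))) ^ k = (real k / (2 * exp 1) * (exp (-1) / pi)) powr (real k / 2)"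
  proof -
    have "sqrt (real k) / (exp 1 * sqrt (2 * pi)) = sqrt (real k / (2 * exp 1) * (exp (-1) / pi))"
      by (simp add: real_sqrt_divide real_sqrt_mult exp_minus field_simps)
    also have "\<dots> = (real k / (2 * exp 1) * (exp (-1) / pi)) powr (1/2)" by (simp add: powr_half_sqrt)
    finally show ?thesis using k by (simp add: powr_realpow[symmetric] powr_powr)
  qed
  also have "\<dots> = (real k / (2 * exp 1)) powr (real k / 2) * (exp (- real k / 2) / pi powr (real k / 2))"
    by (simp add: powr_mult powr_divide exp_powr_real)
  finally have "unit_ball_vol (real k) * (sqrt (real k) / (exp 1 * sqrt (2 * pi))) ^ k
      = exp (- real k / 2) * ((real k / (2 * exp 1)) powr (real k / 2) / Gamma (real k / 2 + 1))"
    unfolding unit_ball_vol_def by (simp add: field_simps)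
  also have "\<dots> \<le> exp (- real k / 2) * (c * sqrt (2 / (pi * ?m)))"
    using powr_le_Gamma[of k "d + 1"] k Gp unfolding sp by (intro mult_left_mono) (auto simp: field_simps)
  finally have "unit_ball_vol (real k) * (sqrt (real k) / (exp 1 * sqrt (2 * pi))) ^ k * unit_ball_vol ?m
      \<le> exp (- real k / 2) * (c * sqrt (2 / (pi * ?m))) * unit_ball_vol ?m"
    by (intro mult_right_mono) auto
  also have "\<dots> = c * exp (- real k / 2) * (unit_ball_vol ?m * sqrt (2 / (pi * ?m)))" by simp
  also have "\<dots> \<le> c * sqrt (real d / real (d + k)) ^ d * (2 * unit_ball_vol (real d) / ?m)"
    using c0 by (intro mult_mono mult_nonneg_nonneg unit_ball_vol_ratio exp_le_sqrt_ratio_power[OF k]) auto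
  finally show ?thesis unfolding c_def by (simp add: mult_ac)
qed

section \<open>Spectral norm and condition number\<close>

text \<open>The norm of the type \<open>real ^ 'n ^ 'm\<close> is the Frobenius norm;
  Cauchy--Schwarz is applied row by row.\<close>

lemma norm_matrix_vector_le: "norm (A *v x) \<le> norm A * norm x"
  for A :: "real ^ 'n ^ 'm"
proof -
  have "norm (A *v x) = L2_set (\<lambda>i. A $ i \<bullet> x) UNIV"
    by (simp add: norm_vec_def matrix_mult_dot L2_set_def)
  also have "\<dots> = L2_set (\<lambda>i. \<bar>A $ i \<bullet> x\<bar>) UNIV" by (simp add: L2_set_def)
  also have "\<dots> \<le> L2_set (\<lambda>i. norm (A $ i) * norm x) UNIV"
    by (intro L2_set_mono Cauchy_Schwarz_ineq2) auto
  also have "\<dots> = norm A * norm x" by (simp add: L2_set_left_distrib norm_vec_def)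
  finally show ?thesis .
qed

lemma norm_matrix_vector_le_spectral: "norm (A *v x) \<le> spectral_norm A * norm x"
  unfolding spectral_norm_def by (intro onorm matrix_vector_mul_bounded_linear)

lemma spectral_norm_nonneg: "0 \<le> spectral_norm A"
  unfolding spectral_norm_def by (intro onorm_pos_le matrix_vector_mul_bounded_linear)

lemma spectral_norm_le_norm: "spectral_norm A \<le> norm A"
  unfolding spectral_norm_def by (intro onorm_bound norm_matrix_vector_le) simp

lemma spectral_norm_add_le: "spectral_norm (A + B) \<le> spectral_norm A + spectral_norm B"
  unfolding spectral_norm_def matrix_vector_mult_add_rdistrib
  by (intro onorm_triangle matrix_vector_mul_bounded_linear)

lemma spectral_norm_scaleR: "spectral_norm (c *\<^sub>R A) = \<bar>c\<bar> * spectral_norm A"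
proof -
  have "(c *\<^sub>R A) *v x = c *\<^sub>R (A *v x)" for x by (simp add: scaleR_matrix_vector_assoc)
  then have "(*v) (c *\<^sub>R A) = (\<lambda>x. c *\<^sub>R (A *v x))" by (rule ext)
  then show ?thesis unfolding spectral_norm_def by (simp add: onorm_scaleR[OF matrix_vector_mul_bounded_linear])
qed

text \<open>The right side is the Euclidean distance of the entries, the metric in which
  \<open>gaussian_concentration\<close> asks for a 1-Lipschitz function.\<close>

lemma spectral_norm_lipschitz: "\<bar>spectral_norm A - spectral_norm B\<bar> \<le> norm (A - B)"
proof -
  have "spectral_norm A - spectral_norm B \<le> norm (A - B)" for A B :: "real ^ 'n ^ 'm"
    using spectral_norm_add_le[of "A - B" B] spectral_norm_le_norm[of "A - B"] by simp
  from this[of A B] this[of B A] show ?thesis by (simp add: norm_minus_commute abs_le_iff)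
qed

lemma continuous_on_spectral_norm: "continuous_on S (spectral_norm :: real ^ 'n ^ 'm \<Rightarrow> real)"
  unfolding continuous_on_iff
  by (metis dist_norm dist_real_def le_less_trans spectral_norm_lipschitz)

lemma borel_measurable_spectral_norm [measurable]:
  "(spectral_norm :: real ^ 'n ^ 'm \<Rightarrow> real) \<in> borel_measurable borel"
  by (intro borel_measurable_continuous_onI continuous_on_spectral_norm)

text \<open>The test vector consists of the signs of row i. In expectation this bounds Q from below
  by the mean of |N(0,1)|.\<close>

lemma sum_abs_row_le_spectral_norm:
  fixes A :: "real ^ 'n ^ 'm"
  shows "(\<Sum>j\<in>UNIV. \<bar>A $ i $ j\<bar>) \<le> sqrt (real CARD('n)) * spectral_norm A"
proof -
  define v :: "real ^ 'n" where "v = (\<chi> j. sgn (A $ i $ j))"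
  have "norm v \<le> sqrt (\<Sum>j\<in>(UNIV :: 'n set). 1)"
    unfolding norm_vec_def L2_set_def v_def by (intro real_sqrt_le_mono sum_mono) (auto simp: sgn_real_def)
  then have v: "norm v \<le> sqrt (real CARD('n))" by simp
  have "(\<Sum>j\<in>UNIV. \<bar>A $ i $ j\<bar>) = (A *v v) $ i"
    unfolding matrix_vector_mult_def v_def by (simp add: abs_sgn mult.commute)
  also have "\<dots> \<le> norm (A *v v)" using component_le_norm_cart[of "A *v v" i] by simp
  also have "\<dots> \<le> spectral_norm A * norm v" by (rule norm_matrix_vector_le_spectral)
  also have "\<dots> \<le> spectral_norm A * sqrt (real CARD('n))" using v spectral_norm_nonneg by (intro mult_left_mono)
  finally show ?thesis by (simp add: mult.commute)
qed

text \<open>This serves twice: through the l1 norm for the integrability of the spectral norm, and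
  for the lower bound on Q.\<close>

lemma has_bochner_integral_gaussian_abs_inner:
  fixes b :: "'a::euclidean_space"
  assumes b: "b \<in> Basis"
  shows "has_bochner_integral (gaussian 0 1) (\<lambda>x. \<bar>x \<bullet> b\<bar>) (sqrt (2 / pi))"
proof -
  let ?N = "\<lambda>_::'a. density lborel (\<lambda>x. ennreal (normal_density 0 1 x))"
  let ?T = "\<lambda>g. \<Sum>i\<in>Basis. g i *\<^sub>R id i :: 'a"
  have ps: "prob_space (?N i)" for i by (intro prob_space_normal_density) simp
  have g: "gaussian (0::'a) 1 = distr (PiM Basis ?N) borel ?T"
    using gaussian_eq_distr_PiM[OF finite_Basis bij_betw_id, of 1 "0::'a"] by simp
  have "has_bochner_integral lborel (\<lambda>x. std_normal_density x *\<^sub>R \<bar>x\<bar>) (sqrt (2 / pi))"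
    using std_normal_moment_abs_odd[of 0] by simp
  then have "has_bochner_integral (?N b) (\<lambda>x. \<bar>x\<bar>) (sqrt (2 / pi))"
    by (intro has_bochner_integral_density) auto
  then have "has_bochner_integral (distr (PiM Basis ?N) (?N b) (\<lambda>g. g b)) (\<lambda>x. \<bar>x\<bar>) (sqrt (2 / pi))"
    using distr_PiM_component[of Basis ?N b] ps b by simp
  then have "has_bochner_integral (PiM Basis ?N) (\<lambda>g. \<bar>g b\<bar>) (sqrt (2 / pi))"
    using b by (simp add: has_bochner_integral_iff integrable_distr_eq integral_distr)
  moreover have "?T g \<bullet> b = g b" for g using b by (simp add: inner_sum_left_Basis)
  ultimately have "has_bochner_integral (PiM Basis ?N) (\<lambda>g. \<bar>?T g \<bullet> b\<bar>) (sqrt (2 / pi))" by simp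
  then show ?thesis unfolding g by (intro has_bochner_integral_distr) auto
qed

section \<open>Expectation and tail of the spectral norm\<close>

lemma integrable_spectral_norm: "integrable (gaussian 0 1) (spectral_norm :: real ^ 'n ^ 'm \<Rightarrow> real)"
proof (rule Bochner_Integration.integrable_bound)
  show "integrable (gaussian 0 1) (\<lambda>X :: real ^ 'n ^ 'm. \<Sum>b\<in>Basis. \<bar>X \<bullet> b\<bar>)"
    using has_bochner_integral_gaussian_abs_inner by (intro Bochner_Integration.integrable_sum) (auto simp: has_bochner_integral_iff)
  show "AE X in gaussian 0 1. norm (spectral_norm (X :: real ^ 'n ^ 'm)) \<le> norm (\<Sum>b\<in>Basis. \<bar>X \<bullet> b\<bar>)"
  proof (intro AE_I2)
    fix X :: "real ^ 'n ^ 'm"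
    have "spectral_norm X \<le> (\<Sum>b\<in>Basis. \<bar>X \<bullet> b\<bar>)"
      using spectral_norm_le_norm[of X] norm_le_l1[of X] by linarith
    then show "norm (spectral_norm X) \<le> norm (\<Sum>b\<in>Basis. \<bar>X \<bullet> b\<bar>)" using spectral_norm_nonneg[of X] by simp
  qed
qed simp

lemma expectation_spectral_norm:
  "(\<integral>X. spectral_norm X \<partial>gaussian (0 :: real ^ 'n ^ 'm) 1) = sqrt (real CARD('n)) * Q_norm TYPE('m) TYPE('n)"
  unfolding Q_norm_def gaussian_matrix_eq_gaussian[OF zero_less_one] by simp

text \<open>Since pi <= 4 this gives Q >= 1 / sqrt 2, from which the final argument obtains z >=
  1/2.\<close>

lemma Q_norm_ge: "sqrt (2 / pi) \<le> Q_norm TYPE('m::finite) TYPE('n::finite)"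
proof -
  obtain i :: 'm where True by simp
  let ?n = "real CARD('n)"
  have b: "axis i (axis j 1) \<in> (Basis :: (real ^ 'n ^ 'm) set)" for j
    by (auto simp: Basis_vec_def)
  have hb: "has_bochner_integral (gaussian 0 1) (\<lambda>X :: real ^ 'n ^ 'm. \<bar>X $ i $ j\<bar>) (sqrt (2 / pi))" for j
    using has_bochner_integral_gaussian_abs_inner[OF b[of j]] by (simp add: inner_axis)
  then have "has_bochner_integral (gaussian 0 1) (\<lambda>X :: real ^ 'n ^ 'm. \<Sum>j\<in>UNIV. \<bar>X $ i $ j\<bar>) (\<Sum>j\<in>(UNIV :: 'n set). sqrt (2 / pi))"
    by (intro has_bochner_integral_sum)
  then have I: "integrable (gaussian 0 1) (\<lambda>X :: real ^ 'n ^ 'm. \<Sum>j\<in>UNIV. \<bar>X $ i $ j\<bar>)"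
    "(\<integral>X. (\<Sum>j\<in>UNIV. \<bar>X $ i $ j\<bar>) \<partial>gaussian (0 :: real ^ 'n ^ 'm) 1) = ?n * sqrt (2 / pi)"
    by (auto simp: has_bochner_integral_iff)
  have "?n * sqrt (2 / pi) \<le> (\<integral>X. sqrt ?n * spectral_norm X \<partial>gaussian (0 :: real ^ 'n ^ 'm) 1)"
    unfolding I(2)[symmetric]
    by (intro integral_mono I(1) integrable_mult_right integrable_spectral_norm sum_abs_row_le_spectral_norm)
  also have "\<dots> = ?n * Q_norm TYPE('m) TYPE('n)" by (simp add: expectation_spectral_norm)
  finally show ?thesis by (simp add: mult_le_cancel_left)
qed

text \<open>Truncation at the threshold \<mu> + s supplies boundedness. It can only lower the mean,
  and on the event in question the truncated function still equals \<mu> + s, so the event for the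
  truncated function contains the original one.\<close>

lemma spectral_norm_concentration:
  assumes s: "0 \<le> s"
  shows "measure (gaussian (0 :: real ^ 'n ^ 'm) 1)
      {X. sqrt (real CARD('n)) * Q_norm TYPE('m) TYPE('n) + s \<le> spectral_norm X} \<le> exp (- s\<^sup>2 / 2)"
proof -
  let ?M = "PiM UNIV (\<lambda>_::'m \<times> 'n. density lborel (\<lambda>x. ennreal (normal_density 0 1 x)))"
  let ?T = "\<lambda>g. (\<chi> i j. g (i, j)) :: real ^ 'n ^ 'm"
  interpret M: prob_space ?M by (intro prob_space_PiM prob_space_std_normal)
  have T[measurable]: "?T \<in> borel_measurable ?M"
    unfolding sum_axis_axis[symmetric] by measurable
  have g: "gaussian (0 :: real ^ 'n ^ 'm) 1 = distr ?M borel ?T"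
    using gaussian_eq_distr_PiM[OF finite bij_betw_axis_axis zero_less_one, of "0 :: real ^ 'n ^ 'm"]
    unfolding sum_axis_axis by simp
  define \<mu> where "\<mu> = sqrt (real CARD('n)) * Q_norm TYPE('m) TYPE('n)"
  have int: "integrable ?M (\<lambda>x. spectral_norm (?T x))" and \<mu>: "(\<integral>x. spectral_norm (?T x) \<partial>?M) = \<mu>"
    using integrable_spectral_norm[where 'n = 'n and 'm = 'm] expectation_spectral_norm[where 'n = 'n and 'm = 'm]
    unfolding g \<mu>_def
    by (simp_all add: integrable_distr_eq integral_distr)
  define h where "h = (\<lambda>x. min (spectral_norm (?T x)) (\<mu> + s))"
  have \<mu>0: "0 \<le> \<mu>" unfolding \<mu>[symmetric] by (intro Bochner_Integration.integral_nonneg spectral_norm_nonneg)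
  have hm[measurable]: "h \<in> borel_measurable ?M" unfolding h_def by measurable
  have hb: "0 \<le> h x \<and> h x \<le> \<mu> + s" for x unfolding h_def using \<mu>0 s by (simp add: spectral_norm_nonneg)
  have lip: "\<bar>h x - h y\<bar> \<le> sqrt (\<Sum>p\<in>UNIV. (x p - y p)\<^sup>2)" for x y
  proof -
    have "\<bar>h x - h y\<bar> \<le> \<bar>spectral_norm (?T x) - spectral_norm (?T y)\<bar>" unfolding h_def by (simp add: min_def)
    also have "\<dots> \<le> norm (?T x - ?T y)" by (rule spectral_norm_lipschitz)
    also have "\<dots> = sqrt (\<Sum>i\<in>UNIV. \<Sum>j\<in>UNIV. (x (i, j) - y (i, j))\<^sup>2)"
      by (simp add: norm_vec_def L2_set_def sum_nonneg)
    also have "\<dots> = sqrt (\<Sum>p\<in>UNIV. (x p - y p)\<^sup>2)"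
      by (simp add: sum.cartesian_product UNIV_Times_UNIV[symmetric] del: UNIV_Times_UNIV)
    finally show ?thesis .
  qed
  have "(\<integral>x. h x \<partial>?M) \<le> \<mu>"
    unfolding \<mu>[symmetric] using hb
    by (intro integral_mono int M.integrable_const_bound[where B = "\<mu> + s"] AE_I2) (auto simp: h_def)
  then have sub: "{x. \<mu> + s \<le> spectral_norm (?T x)} \<subseteq> {x. (\<integral>x. h x \<partial>?M) + s \<le> h x}" by (auto simp: h_def)
  have "measure (gaussian (0 :: real ^ 'n ^ 'm) 1) {X. \<mu> + s \<le> spectral_norm X} = measure ?M {x. \<mu> + s \<le> spectral_norm (?T x)}"
    unfolding g by (subst measure_distr) (auto simp: space_PiM)
  also have "\<dots> \<le> measure ?M {x. (\<integral>x. h x \<partial>?M) + s \<le> h x}"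
  proof (rule M.finite_measure_mono[OF sub])
    have "{x \<in> space ?M. (\<integral>x. h x \<partial>?M) + s \<le> h x} \<in> sets ?M" by measurable
    then show "{x. (\<integral>x. h x \<partial>?M) + s \<le> h x} \<in> sets ?M" by (simp add: space_PiM)
  qed
  also have "\<dots> \<le> exp (- s\<^sup>2 / 2)"
    by (rule gaussian_concentration[OF _ hm hb lip s]) simp
  finally show ?thesis unfolding \<mu>_def .
qed

section \<open>Moore-Penrose inverse and smallest singular value\<close>

lemma scaleR_vector_matrix_mult: "(c *\<^sub>R y) v* A = c *\<^sub>R (y v* A)"
  for A :: "real ^ 'n ^ 'm"
  by (simp add: vec_eq_iff vector_matrix_mult_def sum_distrib_left mult_ac)

text \<open>Let the unit vector x maximise the length of its image w under the pseudo-inverse, and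
  let y solve A A^T y = x, so that w = A^T y. Then |w|^2 = y . x <= |y|, and y / |y| is a witness
  with value |w| / |y| <= 1 / |w| <= 1 / T.\<close>

lemma small_singular_of_moore_penrose:
  fixes A :: "real ^ 'n ^ 'm"
  assumes T: "0 < T" "T \<le> spectral_norm (moore_penrose A)"
  shows "A \<in> small_singular (1 / T)"
proof -
  let ?G = "A ** transpose A"
  have Gy: "?G *v y = A *v (y v* A)" for y
    by (simp add: matrix_vector_mul_assoc[symmetric])
  have normal: "norm (y v* A) ^ 2 = y \<bullet> (?G *v y)" for y
    unfolding Gy power2_norm_eq_inner dot_lmul_matrix ..
  show ?thesis
  proof (cases "invertible ?G")
    \<comment> \<open>A kernel vector y of A A^T satisfies y^T A = 0 and is, after scaling, a
      witness at every level; the unspecified value of \<open>matrix_inv\<close> therefore does no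
      harm.\<close>
    case False
    then obtain y where y: "?G *v y = 0" "y \<noteq> 0"
      unfolding invertible_left_inverse matrix_left_invertible_ker by blast
    then have "norm (y v* A) ^ 2 = 0" unfolding normal by simp
    then have "norm ((y /\<^sub>R norm y) v* A) = 0" by (simp add: scaleR_vector_matrix_mult)
    then show ?thesis unfolding small_singular_def using y T by (auto intro!: exI[of _ "y /\<^sub>R norm y"])
  next
    case True
    define B where "B = moore_penrose A"
    have "continuous_on (sphere 0 1) (\<lambda>x. norm (B *v x))" by (intro continuous_intros matrix_vector_mult_linear_continuous_on)
    moreover have "sphere 0 1 \<noteq> ({} :: (real ^ 'm) set)" by simp
    ultimately obtain x where x: "norm x = 1" "\<And>x'. norm x' = 1 \<Longrightarrow> norm (B *v x') \<le> norm (B *v x)"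
      using continuous_attains_sup[OF compact_sphere] by (metis mem_sphere_0)
    have "norm (B *v v) \<le> norm (B *v x) * norm v" for v
    proof (cases "v = 0")
      case False
      then have "norm (B *v (v /\<^sub>R norm v)) \<le> norm (B *v x)" by (intro x(2)) simp
      then show ?thesis using False by (simp add: matrix_vector_mult_scaleR field_simps)
    qed simp
    then have "spectral_norm B \<le> norm (B *v x)" unfolding spectral_norm_def by (intro onorm_bound) auto
    define w where "w = B *v x"
    have wT: "T \<le> norm w" using T(2) \<open>spectral_norm B \<le> norm (B *v x)\<close> unfolding w_def B_def by linarith
    define y where "y = matrix_inv ?G *v x"
    have w: "w = y v* A" unfolding w_def B_def moore_penrose_def y_def by (simp add: matrix_vector_mul_assoc[symmetric])
    have "?G ** matrix_inv ?G = mat 1"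
      using True unfolding invertible_def matrix_inv_def by (metis (mono_tags, lifting) someI_ex)
    then have "?G *v y = x" unfolding y_def by (simp only: matrix_vector_mul_assoc matrix_vector_mul_lid)
    then have "norm w ^ 2 = y \<bullet> x" unfolding w normal by simp
    also have "\<dots> \<le> norm y" using norm_cauchy_schwarz[of y x] x(1) by simp
    finally have wy: "norm w ^ 2 \<le> norm y" .
    have w0: "norm w > 0" using wT T(1) by linarith
    then have y0: "norm y > 0" using wy by (metis less_le_trans zero_less_power)
    have "norm ((y /\<^sub>R norm y) v* A) = norm w / norm y"
      unfolding w by (simp add: scaleR_vector_matrix_mult field_simps)
    also have "\<dots> \<le> 1 / norm w" using wy w0 y0 by (simp add: field_simps power2_eq_square)
    also have "\<dots> \<le> 1 / T" using wT T(1) w0 by (intro divide_left_mono) auto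
    finally show ?thesis unfolding small_singular_def using y0 by (auto intro!: exI[of _ "y /\<^sub>R norm y"])
  qed
qed

section \<open>Tail bounds for the two events and the conclusion\<close>

lemma measure_spectral_norm_ge:
  fixes Abar :: "real ^ 'n ^ 'm"
  assumes A: "spectral_norm Abar \<le> 1" and \<sigma>: "0 < \<sigma>" and s: "0 \<le> s"
  shows "measure (gaussian Abar \<sigma>)
      {A. \<sigma> * (sqrt (real CARD('n)) * Q_norm TYPE('m) TYPE('n) + s) + 1 \<le> spectral_norm A} \<le> exp (- s\<^sup>2 / 2)"
proof -
  let ?q = "sqrt (real CARD('n)) * Q_norm TYPE('m) TYPE('n) + s"
  interpret G: prob_space "gaussian (0 :: real ^ 'n ^ 'm) 1" by (rule prob_space_gaussian) simp
  have "gaussian Abar \<sigma> = distr (distr (gaussian 0 1) borel (\<lambda>X. \<sigma> *\<^sub>R X)) borel (\<lambda>X. Abar + X)"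
    unfolding distr_gaussian_scale[OF \<sigma>] distr_gaussian_translate by simp
  also have "\<dots> = distr (gaussian 0 1) borel (\<lambda>X. Abar + \<sigma> *\<^sub>R X)"
    by (simp add: distr_distr comp_def)
  finally have "measure (gaussian Abar \<sigma>) {A. \<sigma> * ?q + 1 \<le> spectral_norm A}
      = measure (gaussian 0 1) {X. \<sigma> * ?q + 1 \<le> spectral_norm (Abar + \<sigma> *\<^sub>R X)}"
    by (simp add: measure_distr)
  also have "\<dots> \<le> measure (gaussian 0 1) {X :: real ^ 'n ^ 'm. ?q \<le> spectral_norm X}"
  proof (rule G.finite_measure_mono)
    show "{X. \<sigma> * ?q + 1 \<le> spectral_norm (Abar + \<sigma> *\<^sub>R X)} \<subseteq> {X. ?q \<le> spectral_norm X}"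
    proof clarify
      fix X assume "\<sigma> * ?q + 1 \<le> spectral_norm (Abar + \<sigma> *\<^sub>R X)"
      also have "\<dots> \<le> 1 + \<sigma> * spectral_norm X"
        using spectral_norm_add_le[of Abar "\<sigma> *\<^sub>R X"] A \<sigma> by (simp add: spectral_norm_scaleR)
      finally show "?q \<le> spectral_norm X" using \<sigma> by simp
    qed
    have "{X \<in> space borel. ?q \<le> spectral_norm (X :: real ^ 'n ^ 'm)} \<in> sets borel" by measurable
    then show "{X :: real ^ 'n ^ 'm. ?q \<le> spectral_norm X} \<in> sets (gaussian 0 1)" by simp
  qed
  also have "\<dots> \<le> exp (- s\<^sup>2 / 2)" by (rule spectral_norm_concentration[OF s])
  finally show ?thesis .
qed

text \<open>The level is written through b so that the bound reads c(\<lambda>) b^k; the application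
  has b = B / z. Apart from factors free of \<rho>, the averaged estimate divides by \<rho>^k (1 -
  \<rho>^2)^(d/2), which is largest at \<rho>^2 = k / n.\<close>

lemma measure_small_singular_le:
  fixes c :: "real ^ 'n ^ 'm"
  assumes k: "CARD('m) + k = CARD('n) + 1" "1 \<le> k" and m: "CARD('m) = d + 1" and \<sigma>: "0 < \<sigma>" and b: "0 < b"
  shows "measure (gaussian c \<sigma>) (small_singular (real k / real CARD('n) * \<sigma> * sqrt (real CARD('n)) * b / exp 1))
    \<le> c_fun (real d / real CARD('n)) * b ^ k"
proof -
  have n: "CARD('n) = d + k" using k m by simp
  define N where "N = real (d + k)"
  have N: "N > 0" unfolding N_def using k by simp
  define \<tau> where "\<tau> = real k / N * \<sigma> * sqrt N * b / exp 1"
  define \<rho> where "\<rho> = sqrt (real k / N)"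
  have \<tau>: "\<tau> > 0" unfolding \<tau>_def using k N \<sigma> b by simp
  have kN: "real k \<le> N" "d \<noteq> 0 \<Longrightarrow> real k < N" unfolding N_def by simp_all
  have \<rho>: "0 < \<rho>" "\<rho> \<le> 1" "d = 0 \<or> \<rho> < 1" unfolding \<rho>_def using k N kN by auto
  have \<rho>2: "1 - \<rho>\<^sup>2 = real d / N" unfolding \<rho>_def using N by (simp add: N_def field_simps)
  interpret G: prob_space "gaussian c \<sigma>" using \<sigma> by (rule prob_space_gaussian)
  let ?p = "2 * unit_ball_vol (real d) * sqrt (real d / N) ^ d / real (d + 1)"
  let ?q = "sqrt (real k) / (exp 1 * sqrt (2 * pi))"
  \<comment> \<open>For d = 0 this relies on \<open>0 ^ 0 = 1\<close>.\<close>
  have p: "?p > 0" using N by (cases "d = 0") auto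
  \<comment> \<open>The dimension n cancels in \<tau> / \<rho>, which leaves the base that
    \<open>cap_constant_le\<close> expects.\<close>
  have scale: "\<tau> / \<rho> / (sqrt (2 * pi) * \<sigma>) = ?q * b"
  proof -
    have "real k / N = \<rho> * \<rho>" unfolding \<rho>_def using N by simp
    then have "\<tau> / \<rho> = \<rho> * \<sigma> * sqrt N * b / exp 1"
      unfolding \<tau>_def using \<rho>(1) by simp
    also have "\<dots> = sqrt (real k) * \<sigma> * b / exp 1" unfolding \<rho>_def using N by (simp add: real_sqrt_divide)
    finally show ?thesis using \<sigma> by simp
  qed
  have "emeasure (gaussian c \<sigma>) (small_singular \<tau>) * ennreal ?p
      \<le> ennreal (unit_ball_vol (real k) * (?q * b) ^ k * unit_ball_vol (real (d + 1)))"
    using emeasure_small_singular[OF k(1) \<sigma> \<tau> m \<rho>, of c] unfolding \<rho>2 scale .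
  then have "measure (gaussian c \<sigma>) (small_singular \<tau>) * ?p \<le> unit_ball_vol (real k) * (?q * b) ^ k * unit_ball_vol (real (d + 1))"
    using p b by (simp add: G.emeasure_eq_measure ennreal_mult[symmetric])
  also have "\<dots> = unit_ball_vol (real k) * ?q ^ k * unit_ball_vol (real (d + 1)) * b ^ k"
    unfolding power_mult_distrib[of ?q b k] by simp
  also have "\<dots> \<le> (c_fun (real d / N) * ?p) * b ^ k"
    using cap_constant_le[OF k(2), of d] b unfolding N_def by (intro mult_right_mono) auto
  finally have "measure (gaussian c \<sigma>) (small_singular \<tau>) * ?p \<le> (c_fun (real d / N) * b ^ k) * ?p" by (simp add: mult_ac)
  then have "measure (gaussian c \<sigma>) (small_singular \<tau>) \<le> c_fun (real d / N) * b ^ k"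
    using p by (rule mult_right_le_imp_le)
  then show ?thesis unfolding \<tau>_def N_def n by simp
qed

theorem theorem1p1:
  fixes Abar :: "real ^ 'n ^ 'm"
    and P :: "'w measure"
    and A :: "'w \<Rightarrow> real ^ 'n ^ 'm"
    and \<sigma> z lam :: real
    and m n :: nat
  assumes "m = CARD('m)" and "n = CARD('n)"
    and "m \<le> n"
    and "spectral_norm Abar \<le> 1"
    and "0 < \<sigma>" and "\<sigma> \<le> 1"
    and "lam = (real m - 1) / real n"
    and "z \<ge> zeta \<sigma> TYPE('m) TYPE('n)"
    and "prob_space P"
    and "A \<in> measurable P borel"
    and "distr P borel A = gaussian_matrix Abar \<sigma>"
  shows "\<P>(\<omega> in P. cond_number (A \<omega>) \<ge> exp 1 * z / (1 - lam))
    \<le> 2 * c_fun lam *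
        ((Q_norm TYPE('m) TYPE('n) + sqrt (2 * ln (2 * z)) + 1 / (\<sigma> * sqrt (real n))) * (1 / z))
          ^ (n - m + 1)"
proof -
  interpret P: prob_space P by fact
  define k d where "k = n - m + 1" and "d = m - 1"
  have mpos: "m \<ge> 1" using assms(1) by (simp add: Suc_leI)
  have k: "CARD('m) + k = CARD('n) + 1" "1 \<le> k" and d: "CARD('m) = d + 1"
    unfolding k_def d_def using assms(1,2,3) mpos by simp_all
  have n0: "real n > 0" using mpos assms(3) by simp
  have lam: "lam = real d / real n" "1 - lam = real k / real n"
    using mpos assms(3) n0 unfolding assms(7) d_def k_def by (simp_all add: of_nat_diff field_simps)
  define q where "q = Q_norm TYPE('m) TYPE('n)"
  define c where "c = c_fun lam"
  have "real k / real n > 0" using n0 k(2) by simp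
  then have lam0: "0 \<le> lam" "lam < 1" using lam by simp_all
  have c: "c \<ge> 1 / sqrt 2"
  proof -
    have "1 / 2 \<le> (1 + lam) / (2 * (1 - lam))" using lam0 by (simp add: field_simps)
    then show ?thesis unfolding c_def c_fun_def by (metis real_sqrt_divide real_sqrt_le_iff real_sqrt_one)
  qed
  have c0: "c > 0" using c by (rule less_le_trans[rotated]) simp
  have q: "q \<ge> 1 / sqrt 2"
  proof -
    have "1 / 2 \<le> 2 / pi" using pi_less_4 by (simp add: field_simps)
    then have "1 / sqrt 2 \<le> sqrt (2 / pi)" by (metis real_sqrt_divide real_sqrt_le_iff real_sqrt_one)
    then show ?thesis using Q_norm_ge[where 'm = 'm and 'n = 'n] unfolding q_def by linarith
  qed
  then have q0: "q > 0" by (rule less_le_trans[rotated]) simp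
  define r where "r = 1 / (\<sigma> * sqrt (real n))"
  have r0: "r > 0" unfolding r_def using assms(5) n0 by simp
  \<comment> \<open>This makes ln (2 z) nonnegative. As 1 / sqrt 2 < 1, its k-th root is no smaller,
    so both factors of \<open>zeta\<close> are at least 1 / sqrt 2.\<close>
  have z: "z \<ge> 1 / 2"
  proof -
    have e: "real CARD('n) - real CARD('m) + 1 = real k" using k(1) by linarith
    have "1 / sqrt 2 = (1 / sqrt 2) powr 1" by simp
    also have "\<dots> \<le> (1 / sqrt 2) powr (1 / real k)" using k(2) by (intro powr_mono') auto
    also have "\<dots> \<le> c powr (1 / real k)" using c by (intro powr_mono2) auto
    finally have "1 / sqrt 2 * (1 / sqrt 2) \<le> (q + r) * c powr (1 / real k)"
      using q q0 r0 by (intro mult_mono) auto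
    also have "\<dots> = zeta \<sigma> TYPE('m) TYPE('n)"
      unfolding zeta_def e q_def[symmetric] r_def c_def assms(7) using assms(1,2) by simp
    finally show ?thesis using assms(8) by simp
  qed
  define s where "s = sqrt (2 * ln (2 * z))"
  have s0: "s \<ge> 0" unfolding s_def using z by simp
  have s2: "s\<^sup>2 = 2 * ln (2 * z)" unfolding s_def using z by simp
  define B where "B = q + s + r"
  have B: "B \<ge> 1 / sqrt 2" unfolding B_def using q s0 r0 by linarith
  then have B0: "B > 0" by (rule less_le_trans[rotated]) simp
  define \<alpha> where "\<alpha> = \<sigma> * sqrt (real n) * B"
  have \<alpha>0: "\<alpha> > 0" unfolding \<alpha>_def using assms(5) n0 B0 by simp
  \<comment> \<open>Multiplied by \<sigma> sqrt n, the summand r of B becomes the 1 that bounds the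
    norm of \<open>Abar\<close>.\<close>
  have \<alpha>: "\<alpha> = \<sigma> * (sqrt (real n) * q + sqrt (real n) * s) + 1"
    unfolding \<alpha>_def B_def r_def using assms(5) n0 by (simp add: field_simps)
  \<comment> \<open>Fixed by \<alpha> T = e z / (1 - \<lambda>); then 1 / T is the level of
    \<open>measure_small_singular_le\<close> with b = B / z.\<close>
  define T where "T = exp 1 * z / (1 - lam) / \<alpha>"
  have T0: "T > 0" unfolding T_def using z lam0 \<alpha>0 by simp
  have tau: "1 / T = real k / real CARD('n) * \<sigma> * sqrt (real CARD('n)) * (B * (1 / z)) / exp 1"
    unfolding T_def \<alpha>_def lam(2) using assms(2) by (simp add: field_simps)
  define E1 where "E1 = {X :: real ^ 'n ^ 'm. \<alpha> \<le> spectral_norm X}"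
  define E2 where "E2 = (small_singular (1 / T) :: (real ^ 'n ^ 'm) set)"
  let ?G = "gaussian Abar \<sigma>"
  interpret G: prob_space ?G using assms(5) by (rule prob_space_gaussian)
  have E: "E1 \<in> sets borel" "E2 \<in> sets borel"
  proof -
    have "{X \<in> space borel. \<alpha> \<le> spectral_norm (X :: real ^ 'n ^ 'm)} \<in> sets borel" by measurable
    then show "E1 \<in> sets borel" unfolding E1_def by simp
    show "E2 \<in> sets borel" unfolding E2_def by (intro borel_closed closed_small_singular)
  qed
  have M: "distr P borel A = ?G" using assms(11) gaussian_matrix_eq_gaussian[OF assms(5), of Abar] by simp
  \<comment> \<open>Monotonicity asks for measurability of the covering event, which is Borel in A;
    no measurability of \<open>cond_number\<close> enters.\<close>
  have "\<P>(\<omega> in P. cond_number (A \<omega>) \<ge> exp 1 * z / (1 - lam)) \<le> measure P (A -` (E1 \<union> E2) \<inter> space P)"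
  proof (rule P.finite_measure_mono)
    show "{\<omega> \<in> space P. exp 1 * z / (1 - lam) \<le> cond_number (A \<omega>)} \<subseteq> A -` (E1 \<union> E2) \<inter> space P"
    proof clarsimp
      fix \<omega> assume cond: "exp 1 * z / (1 - lam) \<le> cond_number (A \<omega>)" and "A \<omega> \<notin> E2"
      then have "spectral_norm (moore_penrose (A \<omega>)) < T"
        using small_singular_of_moore_penrose[OF T0, of "A \<omega>"] unfolding E2_def by force
      moreover have "\<alpha> * T \<le> spectral_norm (A \<omega>) * spectral_norm (moore_penrose (A \<omega>))"
        using cond \<alpha>0 unfolding cond_number_def T_def by simp
      ultimately have "\<alpha> * T \<le> spectral_norm (A \<omega>) * T"
        by (meson less_imp_le mult_left_mono order_trans spectral_norm_nonneg)
      then show "A \<omega> \<in> E1" unfolding E1_def using T0 by simp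
    qed
    show "A -` (E1 \<union> E2) \<inter> space P \<in> sets P" using E assms(10) by (intro measurable_sets) auto
  qed
  also have "\<dots> = measure ?G (E1 \<union> E2)"
    unfolding M[symmetric] using E assms(10) by (subst measure_distr) auto
  also have "\<dots> \<le> measure ?G E1 + measure ?G E2"
    using E by (intro measure_Un_le) auto
  also have "measure ?G E1 \<le> c * (B * (1 / z)) ^ k"
  proof -
    have "measure ?G E1 \<le> exp (- (sqrt (real n) * s)\<^sup>2 / 2)"
      using measure_spectral_norm_ge[OF assms(4,5), of "sqrt (real n) * s"] s0
      unfolding E1_def \<alpha> q_def assms(2) by simp
    also have "(sqrt (real n) * s)\<^sup>2 / 2 = real n * ln (2 * z)" using s2 by (simp add: power_mult_distrib)
    then have "exp (- (sqrt (real n) * s)\<^sup>2 / 2) = (1 / (2 * z)) ^ n"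
      using z by (simp add: exp_minus exp_of_nat_mult power_one_over inverse_eq_divide)
    \<comment> \<open>Here 2 z >= 1 and n >= k; the surplus exponent is given away.\<close>
    also have "\<dots> \<le> (1 / (2 * z)) ^ k"
      using z mpos assms(3) unfolding k_def by (intro power_decreasing) auto
    also have "\<dots> \<le> c * (B * (1 / z)) ^ k"
    proof -
      \<comment> \<open>It remains to see c (2 B)^k >= 1, for which the lower bounds 1 / sqrt 2 on c
        and on B were prepared.\<close>
      have "1 = (1 / sqrt 2) * sqrt 2" by simp
      also have "\<dots> \<le> c * (2 * B) ^ k"
      proof (rule mult_mono[OF c])
        have "2 * (1 / sqrt 2) = sqrt (2 :: real)" by (simp add: real_div_sqrt)
        then have h: "sqrt 2 \<le> 2 * B" using B by linarith
        also have "2 * B = (2 * B) ^ 1" by simp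
        also have "\<dots> \<le> (2 * B) ^ k"
        proof (rule power_increasing[OF k(2)])
          have "1 \<le> sqrt (2 :: real)" by simp
          then show "1 \<le> 2 * B" using h by linarith
        qed
        finally show "sqrt 2 \<le> (2 * B) ^ k" .
      qed (use c0 in auto)
      finally have "(1 / (2 * z)) ^ k * 1 \<le> (1 / (2 * z)) ^ k * (c * (2 * B) ^ k)"
        using z by (intro mult_left_mono) auto
      also have "\<dots> = c * (B * (1 / z)) ^ k" by (simp add: power_mult_distrib power_divide)
      finally show ?thesis by simp
    qed
    finally show ?thesis .
  qed
  also have "measure ?G E2 \<le> c * (B * (1 / z)) ^ k"
    using measure_small_singular_le[OF k d assms(5), of "B * (1 / z)" Abar] B0 z
    unfolding E2_def tau c_def lam(1) assms(2) by simp
  finally show ?thesis unfolding c_def B_def q_def s_def r_def k_def by (simp add: mult.assoc)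
qed

end
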